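(* Let $n\ge 1$. The $B_n$ Tamari lattice $T_n^B$ has an unrefinable chain of left modular elements.
   Context: Consider a convex, centrally symmetric $(2n+2)$-gon with vertices labelled clockwise $1,2,\dots,n+1,\bar 1,\bar 2,\dots,\overline{n+1}$, so that the half-turn exchanges $i$ and $\bar i$. A triangulation is a division of the polygon into triangles by chords (segments joining two non-adjacent vertices) which do not cross in the interior. $T_n^B$ is the set of triangulations fixed under the half-turn. For a chord $C$, $\bar C$ denotes its image under the half-turn. In a triangulation $S$, each chord $C$ of $S$ is a diagonal of a unique quadrilateral $Q(C)$, the union of the two triangles of $S$ having $C$ as a side. A chord is pure if it joins two barred or two unbarred vertices; otherwise it is mixed. A pure chord $C$ of $S$ is red if $Q(C)$ contains another vertex of the same type (barred/unbarred) as the endpoints of $C$ whose label is higher than those of both endpoints of $C$, and green otherwise. A mixed chord $C$ is red if $Q(C)$ contains an unbarred vertex whose label is higher than that of the unbarred endpoint of $C$, or a barred vertex whose label is higher than that of the barred endpoint of $C$; otherwise it is green. The $B_n$ Tamari lattice is the partial order on $T_n^B$ (which is a lattice) whose covering relations are: $S\lessdot T$ iff $T$ is obtained from $S$ by replacing a green chord $C$ of $S$ and its partner $\bar C$ (possibly $C=\bar C$) by the other diagonals of $Q(C)$ and $Q(\bar C)$. An element $x$ of a lattice $L$ is left modular if $(y\vee x)\wedge z=y\vee(x\wedge z)$ for all $y<z$ in $L$. An unrefinable chain of left modular elements is a maximal chain $\hat 0=x_0\lessdot x_1\lessdot\dots\lessdot x_r=\hat 1$ of $L$, each of whose elements is left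 modular. *)

theory Defs
  imports "HOL-Algebra.Lattice"
begin

section \<open>The polygon\<close>

text \<open>The convex polygon is modelled combinatorially: a chord is the set of its two endpoints, and
  whether two chords cross is read off from the cyclic order of the vertices.\<close>

datatype vertex = Unbarred nat | Barred nat

fun label :: "vertex \<Rightarrow> nat" where
  "label (Unbarred i) = i"
| "label (Barred i) = i"

fun barred :: "vertex \<Rightarrow> bool" where
  "barred (Unbarred i) = False"
| "barred (Barred i) = True"

fun half_turn :: "vertex \<Rightarrow> vertex" where
  "half_turn (Unbarred i) = Barred i"
| "half_turn (Barred i) = Unbarred i"

definition vertices :: "nat \<Rightarrow> vertex set" where
  "vertices n = {v. 1 \<le> label v \<and> label v \<le> n + 1}"

text \<open>Clockwise position, running through \<open>1, \<dots>, 2 * n + 2\<close>.\<close>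

fun pos :: "nat \<Rightarrow> vertex \<Rightarrow> nat" where
  "pos n (Unbarred i) = i"
| "pos n (Barred i) = n + 1 + i"

definition sides :: "nat \<Rightarrow> vertex set set" where
  "sides n = {{u, v} | u v. u \<in> vertices n \<and> v \<in> vertices n \<and>
     (pos n v = pos n u + 1 \<or> pos n u = 2 * n + 2 \<and> pos n v = 1)}"

definition chords :: "nat \<Rightarrow> vertex set set" where
  "chords n = {{u, v} | u v. u \<in> vertices n \<and> v \<in> vertices n \<and> u \<noteq> v} - sides n"

text \<open>Two chords cross in the interior iff exactly one endpoint of the second lies strictly between
  the endpoints \<open>a\<close>, \<open>b\<close> of the first, the other one lying strictly on the other side.\<close>

definition crossing :: "nat \<Rightarrow> vertex set \<Rightarrow> vertex set \<Rightarrow> bool" where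
  "crossing n C D \<longleftrightarrow> (\<exists>a b c d. C = {a, b} \<and> D = {c, d} \<and>
     pos n a < pos n c \<and> pos n c < pos n b \<and> (pos n d < pos n a \<or> pos n b < pos n d))"

section \<open>Triangulations\<close>

definition triangles :: "nat \<Rightarrow> vertex set set \<Rightarrow> vertex set set" where
  "triangles n S = {T. T \<subseteq> vertices n \<and> card T = 3 \<and>
     (\<forall>u\<in>T. \<forall>v\<in>T. u \<noteq> v \<longrightarrow> {u, v} \<in> S \<union> sides n)}"

text \<open>Pairwise non-crossing chords divide the polygon into triangles iff there is a triangle along
  each side of the polygon and a triangle on either side of each chord. By
  \<open>triangulation_iff_maximal\<close> below this means that no further chord can be added.\<close>

definition triangulation :: "nat \<Rightarrow> vertex set set \<Rightarrow> bool" where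
  "triangulation n S \<longleftrightarrow>
     S \<subseteq> chords n \<and>
     (\<forall>C\<in>S. \<forall>D\<in>S. \<not> crossing n C D) \<and>
     (\<forall>e\<in>sides n. card {T \<in> triangles n S. e \<subseteq> T} = 1) \<and>
     (\<forall>C\<in>S. card {T \<in> triangles n S. C \<subseteq> T} = 2)"

definition TB :: "nat \<Rightarrow> vertex set set set" where
  "TB n = {S. triangulation n S \<and> (\<lambda>C. half_turn ` C) ` S = S}"

section \<open>The Tamari order\<close>

text \<open>The quadrilateral \<open>Q(C)\<close>, as the set of its four vertices.\<close>

definition quad :: "nat \<Rightarrow> vertex set set \<Rightarrow> vertex set \<Rightarrow> vertex set" where
  "quad n S C = \<Union>{T \<in> triangles n S. C \<subseteq> T}"

definition pure :: "vertex set \<Rightarrow> bool" where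
  "pure C \<longleftrightarrow> (\<forall>u\<in>C. \<forall>v\<in>C. barred u = barred v)"

definition red :: "nat \<Rightarrow> vertex set set \<Rightarrow> vertex set \<Rightarrow> bool" where
  "red n S C \<longleftrightarrow>
     (if pure C
      then \<exists>w\<in>quad n S C. \<forall>u\<in>C. barred w = barred u \<and> label w > label u
      else \<exists>w\<in>quad n S C. \<exists>u\<in>C. barred w = barred u \<and> label w > label u)"

definition green :: "nat \<Rightarrow> vertex set set \<Rightarrow> vertex set \<Rightarrow> bool" where
  "green n S C \<longleftrightarrow> \<not> red n S C"

text \<open>As \<open>Q(C)\<close> is a set of four vertices, \<open>Q(C) - C\<close> is its other diagonal.\<close>

definition flip :: "nat \<Rightarrow> vertex set set \<Rightarrow> vertex set \<Rightarrow> vertex set set" where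
  "flip n S C = (S - {C, half_turn ` C}) \<union>
     {quad n S C - C, quad n S (half_turn ` C) - half_turn ` C}"

definition flip_cover :: "nat \<Rightarrow> vertex set set \<Rightarrow> vertex set set \<Rightarrow> bool" where
  "flip_cover n S T \<longleftrightarrow> S \<in> TB n \<and> T \<in> TB n \<and> (\<exists>C\<in>S. green n S C \<and> T = flip n S C)"

definition tamari_B :: "nat \<Rightarrow> vertex set set gorder" where
  "tamari_B n = \<lparr>carrier = TB n, eq = (=), le = (flip_cover n)\<^sup>*\<^sup>*\<rparr>"

section \<open>Left modularity\<close>

definition left_modular :: "('a, 'b) gorder_scheme \<Rightarrow> 'a \<Rightarrow> bool" where
  "left_modular L x \<longleftrightarrow> x \<in> carrier L \<and>
     (\<forall>y\<in>carrier L. \<forall>z\<in>carrier L. y \<sqsubset>\<^bsub>L\<^esub> z \<longrightarrow>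
        (y \<squnion>\<^bsub>L\<^esub> x) \<sqinter>\<^bsub>L\<^esub> z = y \<squnion>\<^bsub>L\<^esub> (x \<sqinter>\<^bsub>L\<^esub> z))"

definition covered_by :: "('a, 'b) gorder_scheme \<Rightarrow> 'a \<Rightarrow> 'a \<Rightarrow> bool" where
  "covered_by L x y \<longleftrightarrow> x \<in> carrier L \<and> y \<in> carrier L \<and> x \<sqsubset>\<^bsub>L\<^esub> y \<and>
     \<not> (\<exists>z\<in>carrier L. x \<sqsubset>\<^bsub>L\<^esub> z \<and> z \<sqsubset>\<^bsub>L\<^esub> y)"

definition unrefinable_left_modular_chain :: "('a, 'b) gorder_scheme \<Rightarrow> 'a list \<Rightarrow> bool" where
  "unrefinable_left_modular_chain L xs \<longleftrightarrow>
     xs \<noteq> [] \<and> least L (hd xs) (carrier L) \<and> greatest L (last xs) (carrier L) \<and>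
     successively (covered_by L) xs \<and> (\<forall>x\<in>set xs. left_modular L x)"

section \<open>Triangulations as maximal sets of non-crossing chords\<close>

lemma pos_inj: "u \<in> vertices n \<Longrightarrow> v \<in> vertices n \<Longrightarrow> pos n u = pos n v \<longleftrightarrow> u = v"
  by (cases u; cases v) (auto simp: vertices_def)

lemma pos_range: "u \<in> vertices n \<Longrightarrow> 1 \<le> pos n u \<and> pos n u \<le> 2 * n + 2"
  by (cases u) (auto simp: vertices_def)

lemma pos_surj:
  assumes "1 \<le> k" "k \<le> 2 * n + 2"
  obtains v where "v \<in> vertices n" "pos n v = k"
proof (cases "k \<le> n + 1")
  case True
  then show ?thesis using assms by (intro that[of "Unbarred k"]) (auto simp: vertices_def)
next
  case False
  then show ?thesis using assms by (intro that[of "Barred (k - (n + 1))"]) (auto simp: vertices_def)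
qed

lemma crossI:
  assumes "pos n a < pos n c" "pos n c < pos n b" "pos n b < pos n d"
  shows "crossing n {a, b} {c, d}" "crossing n {c, d} {a, b}"
proof -
  show "crossing n {a, b} {c, d}" unfolding crossing_def
    by (rule exI[of _ a], rule exI[of _ b], rule exI[of _ c], rule exI[of _ d]) (use assms in simp)
  show "crossing n {c, d} {a, b}" unfolding crossing_def
    by (rule exI[of _ c], rule exI[of _ d], rule exI[of _ b], rule exI[of _ a])
      (use assms in \<open>simp add: insert_commute\<close>)
qed

lemma crossE:
  assumes "crossing n C D"
  obtains a b c d where "C = {a, b}" "D = {c, d}"
      "pos n a < pos n c" "pos n c < pos n b" "pos n b < pos n d"
    | a b c d where "C = {a, b}" "D = {c, d}"
      "pos n c < pos n a" "pos n a < pos n d" "pos n d < pos n b"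
proof -
  obtain a b c d where *: "C = {a, b}" "D = {c, d}" "pos n a < pos n c" "pos n c < pos n b"
      "pos n d < pos n a \<or> pos n b < pos n d"
    using assms unfolding crossing_def by (elim exE conjE) rule
  from *(5) show ?thesis
  proof
    assume "pos n d < pos n a"
    then show ?thesis using that(2)[of a b d c] * by (simp add: insert_commute)
  next
    assume "pos n b < pos n d"
    then show ?thesis using that(1)[of a b c d] * by simp
  qed
qed

locale noncrossing =
  fixes n :: nat and S :: "vertex set set"
  assumes n: "n \<ge> 1" and sub: "S \<subseteq> chords n"
    and nc: "\<And>C D. C \<in> S \<Longrightarrow> D \<in> S \<Longrightarrow> \<not> crossing n C D"
begin

abbreviation "E \<equiv> S \<union> sides n"

lemma E_pair:
  assumes "e \<in> E"
  shows "\<exists>u v. e = {u, v} \<and> u \<in> vertices n \<and> v \<in> vertices n \<and> u \<noteq> v"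
proof (cases "e \<in> S")
  case True
  then have "e \<in> chords n" using sub by blast
  then show ?thesis unfolding chords_def by blast
next
  case False
  then have "e \<in> sides n" using assms by blast
  then obtain u v where uv: "e = {u, v}" "u \<in> vertices n" "v \<in> vertices n"
    "pos n v = pos n u + 1 \<or> pos n u = 2 * n + 2 \<and> pos n v = 1"
    unfolding sides_def mem_Collect_eq by (elim exE conjE) rule
  then have "u \<noteq> v" by auto
  then show ?thesis using uv(1-3) by iprover
qed

lemma E_V:
  assumes "{a, b} \<in> E"
  shows "a \<in> vertices n \<and> b \<in> vertices n \<and> a \<noteq> b"
proof -
  obtain u v where "{a, b} = {u, v}" "u \<in> vertices n" "v \<in> vertices n" "u \<noteq> v"
    using E_pair[OF assms] by iprover
  then show ?thesis by (auto simp: doubleton_eq_iff)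
qed

lemma E_obtain:
  assumes "e \<in> E"
  obtains a b where "e = {a, b}" "a \<in> vertices n" "b \<in> vertices n" "pos n a < pos n b"
proof -
  obtain u v where uv: "e = {u, v}" "u \<in> vertices n" "v \<in> vertices n" "u \<noteq> v"
    using E_pair[OF assms] by iprover
  then consider "pos n u < pos n v" | "pos n v < pos n u" using pos_inj[of u n v] by linarith
  then show ?thesis
  proof cases
    case 1 then show ?thesis using that[of u v] uv by simp
  next
    case 2 then show ?thesis using that[of v u] uv by (simp add: insert_commute)
  qed
qed

lemma side_iff:
  assumes "a \<in> vertices n" "b \<in> vertices n" "pos n a < pos n b"
  shows "{a, b} \<in> sides n \<longleftrightarrow> pos n b = pos n a + 1 \<or> pos n a = 1 \<and> pos n b = 2 * n + 2"
proof
  assume "{a, b} \<in> sides n"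
  then obtain u v where uv: "{a, b} = {u, v}"
    "pos n v = pos n u + 1 \<or> pos n u = 2 * n + 2 \<and> pos n v = 1"
    unfolding sides_def mem_Collect_eq by (elim exE conjE) rule
  from uv(1) have "u = a \<and> v = b \<or> u = b \<and> v = a" by (auto simp: doubleton_eq_iff)
  then show "pos n b = pos n a + 1 \<or> pos n a = 1 \<and> pos n b = 2 * n + 2"
    using uv(2) assms(3) by auto
next
  assume "pos n b = pos n a + 1 \<or> pos n a = 1 \<and> pos n b = 2 * n + 2"
  then show "{a, b} \<in> sides n"
  proof
    assume "pos n b = pos n a + 1"
    then show ?thesis unfolding sides_def mem_Collect_eq
      by (intro exI[of _ a] exI[of _ b]) (use assms in simp)
  next
    assume "pos n a = 1 \<and> pos n b = 2 * n + 2"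
    then show ?thesis unfolding sides_def mem_Collect_eq
      by (intro exI[of _ b] exI[of _ a]) (use assms in \<open>simp add: insert_commute\<close>)
  qed
qed

lemma chord_or_side:
  assumes "a \<in> vertices n" "b \<in> vertices n" "a \<noteq> b"
  shows "{a, b} \<in> chords n \<or> {a, b} \<in> sides n"
  using assms unfolding chords_def by blast

lemma E_nc:
  assumes "{a, b} \<in> E" "{c, d} \<in> E" "pos n a < pos n c" "pos n c < pos n b" "pos n b < pos n d"
  shows False
proof (cases "{a, b} \<in> S \<and> {c, d} \<in> S")
  case True
  then show ?thesis using nc crossI(1)[OF assms(3-5)] by blast
next
  case False
  then have "{a, b} \<in> sides n \<or> {c, d} \<in> sides n" using assms by blast
  then show ?thesis
    using side_iff[of a b] side_iff[of c d] E_V[OF assms(1)] E_V[OF assms(2)] assms(3-5)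
      pos_range[of a n] pos_range[of d n] by auto
qed

definition inner :: "vertex \<Rightarrow> vertex \<Rightarrow> vertex \<Rightarrow> bool" where
  "inner a b c \<longleftrightarrow> pos n a < pos n c \<and> pos n c < pos n b \<and> {a, c} \<in> E \<and> {c, b} \<in> E"

definition outer :: "vertex \<Rightarrow> vertex \<Rightarrow> vertex \<Rightarrow> bool" where
  "outer a b c \<longleftrightarrow> (pos n c < pos n a \<or> pos n b < pos n c) \<and> {a, c} \<in> E \<and> {c, b} \<in> E"

definition maxl :: bool where
  "maxl \<longleftrightarrow> (\<forall>C\<in>chords n - S. \<exists>D\<in>S. crossing n C D)"

definition ears :: bool where
  "ears \<longleftrightarrow> (\<forall>a b. {a, b} \<in> E \<longrightarrow> pos n a + 1 < pos n b \<longrightarrow> (\<exists>c. inner a b c))"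

lemma long_side:
  obtains u v where "{u, v} \<in> E" "pos n u = 1" "pos n v = 2 * n + 2"
proof -
  obtain u where u: "u \<in> vertices n" "pos n u = 1" by (rule pos_surj[of 1 n]) auto
  obtain v where v: "v \<in> vertices n" "pos n v = 2 * n + 2" by (rule pos_surj[of "2 * n + 2" n]) auto
  show ?thesis using u v side_iff[of u v] that by auto
qed

lemma inner_unique:
  assumes "inner a b c" "inner a b c'" shows "c = c'"
proof -
  have V: "c \<in> vertices n" "c' \<in> vertices n" using assms E_V unfolding inner_def by blast+
  have *: False if "inner a b c" "inner a b c'" "pos n c < pos n c'" for c c'
    using E_nc[of a c' c b] that unfolding inner_def by simp
  show ?thesis using *[OF assms] *[OF assms(2,1)] pos_inj[OF V] by (cases "pos n c" "pos n c'" rule: linorder_cases) auto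
qed

lemma outer_unique:
  assumes "outer a b c" "outer a b c'" "pos n a < pos n b" shows "c = c'"
proof -
  have V: "c \<in> vertices n" "c' \<in> vertices n" using assms E_V unfolding outer_def by blast+
  have *: False if "outer a b c" "outer a b c'" "pos n c < pos n c'" for c c'
  proof -
    have e: "{a, c} \<in> E" "{c, a} \<in> E" "{c, b} \<in> E" "{b, c} \<in> E"
        "{a, c'} \<in> E" "{c', b} \<in> E" "{b, c'} \<in> E"
      using that(1,2) unfolding outer_def by (simp_all add: insert_commute)
    have "pos n c < pos n a \<or> pos n b < pos n c" "pos n c' < pos n a \<or> pos n b < pos n c'"
      using that(1,2) unfolding outer_def by simp_all
    then consider "pos n c' < pos n a" | "pos n b < pos n c" | "pos n c < pos n a" "pos n b < pos n c'"
      using that(3) by linarith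
    then show False
    proof cases
      case 1 show ?thesis using E_nc[OF e(2) e(6)] 1 that(3) assms(3) by simp
    next
      case 2 show ?thesis using E_nc[OF e(1) e(7)] 2 that(3) assms(3) by simp
    next
      case 3 show ?thesis using E_nc[OF e(3) e(5)] 3 assms(3) by simp
    qed
  qed
  show ?thesis using *[OF assms(1,2)] *[OF assms(2,1)] pos_inj[OF V]
    by (cases "pos n c" "pos n c'" rule: linorder_cases) auto
qed

lemma maxl_imp_ears:
  assumes maxl shows ears
  unfolding ears_def
proof (intro allI impI)
  fix a b assume ab: "{a, b} \<in> E" "pos n a + 1 < pos n b"
  have V: "a \<in> vertices n" "b \<in> vertices n" using E_V[OF ab(1)] by auto
  define P where "P c \<longleftrightarrow> pos n a < pos n c \<and> pos n c < pos n b \<and> {a, c} \<in> E" for c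
  obtain s where s: "s \<in> vertices n" "pos n s = pos n a + 1"
    by (rule pos_surj[of "pos n a + 1" n]) (use ab(2) pos_range[OF V(2)] in auto)
  have "{a, s} \<in> sides n" using s side_iff[OF V(1) s(1)] by simp
  then have "P s" using s(2) ab(2) unfolding P_def by simp
  moreover have "\<forall>y. P y \<longrightarrow> pos n y < pos n b" unfolding P_def by simp
  ultimately have "\<exists>c. P c \<and> (\<forall>x. P x \<longrightarrow> pos n x \<le> pos n c)"
    by (rule Lattices_Big.ex_has_greatest_nat)
  then obtain c where c: "P c" "\<And>x. P x \<Longrightarrow> pos n x \<le> pos n c" by blast
  have cV: "c \<in> vertices n" using c(1) E_V unfolding P_def by blast
  have "{c, b} \<in> E"
  proof (rule ccontr)
    assume no: "{c, b} \<notin> E"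
    have "c \<noteq> b" using c(1) unfolding P_def by auto
    then have "{c, b} \<in> chords n - S" using chord_or_side[OF cV V(2)] no by auto
    then obtain D where D: "D \<in> S" "crossing n {c, b} D" using assms unfolding maxl_def by blast
    have cb: "pos n c < pos n b" "pos n a < pos n c" "{a, c} \<in> E" using c(1) unfolding P_def by auto
    obtain d e where de: "D = {d, e}" "pos n c < pos n d" "pos n d < pos n b"
        "pos n e < pos n c \<or> pos n b < pos n e"
      using D(2)
    proof (cases rule: crossE)
      case (1 a' b' c' d')
      then have "a' = c" "b' = b" using cb by (auto simp: doubleton_eq_iff)
      then show ?thesis using 1 that[of c' d'] by auto
    next
      case (2 a' b' c' d')
      then have "a' = c" "b' = b" using cb by (auto simp: doubleton_eq_iff)
      then show ?thesis using 2 that[of d' c'] by auto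
    qed
    have dE: "{d, e} \<in> E" "{e, d} \<in> E" using D de by (auto simp: insert_commute)
    have eV: "e \<in> vertices n" using E_V[OF dE(1)] by auto
    consider "pos n b < pos n e" | "pos n e < pos n a" | "pos n a < pos n e" "pos n e < pos n c"
      | "pos n e = pos n a" using de(4) by linarith
    then show False
    proof cases
      case 1 show ?thesis using E_nc[OF ab(1) dE(1)] 1 de cb by auto
    next
      case 2 show ?thesis using E_nc[OF dE(2) ab(1)] 2 de cb by auto
    next
      case 3 show ?thesis using E_nc[OF cb(3) dE(2)] 3 de cb by auto
    next
      case 4
      then have "e = a" using pos_inj[OF eV V(1)] by auto
      then have "P d" using dE de cb unfolding P_def by auto
      then show ?thesis using c(2)[of d] de by auto
    qed
  qed
  then show "\<exists>c. inner a b c" using c(1) unfolding P_def inner_def by blast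
qed

lemma enclosing:
  assumes "Q u0 v0"
  obtains u v where "Q u v"
    "\<And>x y. Q x y \<Longrightarrow> pos n v - pos n u \<le> pos n y - pos n x"
proof -
  have "\<exists>z. (case z of (u, v) \<Rightarrow> Q u v) \<and>
      (\<forall>y. (case y of (u, v) \<Rightarrow> Q u v) \<longrightarrow>
         (case z of (u, v) \<Rightarrow> pos n v - pos n u) \<le> (case y of (u, v) \<Rightarrow> pos n v - pos n u))"
    by (rule ex_has_least_nat[of _ "(u0, v0)"]) (use assms in simp)
  then show ?thesis using that by auto
qed

lemma ears_imp_maxl:
  assumes ears shows maxl
  unfolding maxl_def
proof (intro ballI, rule ccontr)
  fix C assume C: "C \<in> chords n - S" and no: "\<not> (\<exists>D\<in>S. crossing n C D)"
  obtain c d where cd: "C = {c, d}" "c \<in> vertices n" "d \<in> vertices n" "pos n c < pos n d"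
  proof -
    obtain c d where "C = {c, d}" "c \<in> vertices n" "d \<in> vertices n" "c \<noteq> d"
      using C unfolding chords_def by blast
    moreover from this have "pos n c < pos n d \<or> pos n d < pos n c"
      using pos_inj[of c n d] by linarith
    ultimately show ?thesis using that[of c d] that[of d c] by (metis insert_commute)
  qed
  have CE: "{c, d} \<notin> E" using C cd unfolding chords_def by auto
  have noE: "\<not> crossing n {c, d} {x, y}" if "{x, y} \<in> S" for x y using no that cd by blast
  define Q where "Q u v \<longleftrightarrow> {u, v} \<in> E \<and> pos n u \<le> pos n c \<and> pos n d \<le> pos n v" for u v
  obtain u0 v0 where "{u0, v0} \<in> E" "pos n u0 = 1" "pos n v0 = 2 * n + 2" by (rule long_side)
  then have "Q u0 v0" unfolding Q_def using pos_range[OF cd(2)] pos_range[OF cd(3)] by auto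
  then obtain u v where uv: "Q u v" "\<And>x y. Q x y \<Longrightarrow> pos n v - pos n u \<le> pos n y - pos n x"
    by (rule enclosing) blast
  have uE: "{u, v} \<in> E" using uv unfolding Q_def by auto
  have V: "u \<in> vertices n" "v \<in> vertices n" using E_V[OF uE] by auto
  have le: "pos n u \<le> pos n c" "pos n d \<le> pos n v" using uv unfolding Q_def by auto
  have ne: "\<not> (u = c \<and> v = d)" using uE CE by auto
  then have lt: "pos n u < pos n c \<or> pos n d < pos n v"
    using le pos_inj[OF V(1) cd(2)] pos_inj[OF V(2) cd(3)] by linarith
  then have "pos n u + 1 < pos n v" using le cd(4) by linarith
  then obtain x where x: "inner u v x" using assms uE unfolding ears_def by blast
  have xx: "pos n u < pos n x" "pos n x < pos n v" "{u, x} \<in> E" "{x, v} \<in> E"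
    using x unfolding inner_def by auto
  have "\<not> Q x v" "\<not> Q u x" using uv(2)[of x v] uv(2)[of u x] xx(1,2) by linarith+
  then have cxd: "pos n c < pos n x" "pos n x < pos n d"
    using xx le unfolding Q_def by auto
  have xV: "x \<in> vertices n" using E_V[OF xx(3)] by auto
  from lt show False
  proof
    assume l: "pos n u < pos n c"
    have "{u, x} \<notin> S" using noE[of u x] crossI(2)[OF l cxd] by auto
    then have "{u, x} \<in> sides n" using xx by auto
    then show False using side_iff[OF V(1) xV xx(1)] l cxd pos_range[OF cd(3)] by auto
  next
    assume l: "pos n d < pos n v"
    have "{x, v} \<notin> S" using noE[of x v] crossI(1)[OF cxd l] by auto
    then have "{x, v} \<in> sides n" using xx by auto
    then show False using side_iff[OF xV V(2) xx(2)] l cxd pos_range[OF cd(2)] by auto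
  qed
qed

lemma outer_exists:
  assumes ears "{a, b} \<in> E" "pos n a < pos n b" "\<not> (pos n a = 1 \<and> pos n b = 2 * n + 2)"
  shows "\<exists>c. outer a b c"
proof -
  have V: "a \<in> vertices n" "b \<in> vertices n" using E_V[OF assms(2)] by auto
  define Q where "Q u v \<longleftrightarrow> {u, v} \<in> E \<and> pos n u \<le> pos n a \<and> pos n b \<le> pos n v \<and>
    \<not> (u = a \<and> v = b)" for u v
  obtain u0 v0 where "{u0, v0} \<in> E" "pos n u0 = 1" "pos n v0 = 2 * n + 2" by (rule long_side)
  then have "Q u0 v0" unfolding Q_def using pos_range[OF V(1)] pos_range[OF V(2)] assms(4) by auto
  then obtain u v where uv: "Q u v" "\<And>x y. Q x y \<Longrightarrow> pos n v - pos n u \<le> pos n y - pos n x"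
    by (rule enclosing) blast
  have uE: "{u, v} \<in> E" and le: "pos n u \<le> pos n a" "pos n b \<le> pos n v"
    and ne: "\<not> (u = a \<and> v = b)" using uv unfolding Q_def by auto
  have UV: "u \<in> vertices n" "v \<in> vertices n" using E_V[OF uE] by auto
  have lt: "pos n u < pos n a \<or> pos n b < pos n v"
    using le ne pos_inj[OF UV(1) V(1)] pos_inj[OF UV(2) V(2)] by linarith
  then have "pos n u + 1 < pos n v" using le assms(3) by linarith
  then obtain x where x: "inner u v x" using assms(1) uE unfolding ears_def by blast
  have xx: "pos n u < pos n x" "pos n x < pos n v" "{u, x} \<in> E" "{x, v} \<in> E"
    using x unfolding inner_def by auto
  have nQ: "\<not> Q x v" "\<not> Q u x" using uv(2)[of x v] uv(2)[of u x] xx(1,2) by linarith+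
  consider "pos n x \<le> pos n a" | "pos n b \<le> pos n x" | "pos n a < pos n x" "pos n x < pos n b"
    by linarith
  then show ?thesis
  proof cases
    case 1
    then have "x = a" "v = b" using nQ(1) xx le unfolding Q_def by auto
    then have "outer a b u" using xx uE unfolding outer_def by (auto simp: insert_commute)
    then show ?thesis by blast
  next
    case 2
    then have "u = a" "x = b" using nQ(2) xx le unfolding Q_def by auto
    then have "outer a b v" using xx uE unfolding outer_def by (auto simp: insert_commute)
    then show ?thesis by blast
  next
    case 3
    then show ?thesis
      using lt E_nc[OF xx(3) assms(2)] E_nc[OF assms(2) xx(4)] by auto
  qed
qed

definition apexes :: "vertex \<Rightarrow> vertex \<Rightarrow> vertex set" where
  "apexes a b = {c. inner a b c} \<union> {c. outer a b c}"

lemma card_triangles: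
  assumes "{a, b} \<in> E" "pos n a < pos n b"
  shows "card {T \<in> triangles n S. {a, b} \<subseteq> T} = card (apexes a b)"
proof -
  have "bij_betw (\<lambda>c. {a, b, c}) (apexes a b) {T \<in> triangles n S. {a, b} \<subseteq> T}"
    unfolding bij_betw_def
  proof
    have ne: "c \<noteq> a \<and> c \<noteq> b \<and> c \<in> vertices n \<and> {a, c} \<in> E \<and> {c, b} \<in> E" if "c \<in> apexes a b" for c
      using that E_V[of a c] E_V[of c b] unfolding apexes_def inner_def outer_def by auto
    show "inj_on (\<lambda>c. {a, b, c}) (apexes a b)"
    proof (rule inj_onI)
      fix x y assume x: "x \<in> apexes a b" and eq: "{a, b, x} = {a, b, y}"
      have "x \<in> {a, b, y}" unfolding eq[symmetric] by simp
      then show "x = y" using ne[OF x] by simp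
    qed
    show "(\<lambda>c. {a, b, c}) ` apexes a b = {T \<in> triangles n S. {a, b} \<subseteq> T}"
    proof (intro equalityI subsetI)
      fix T assume "T \<in> (\<lambda>c. {a, b, c}) ` apexes a b"
      then obtain c where c: "T = {a, b, c}" "c \<in> apexes a b" by blast
      have "card T = 3" using c ne[OF c(2)] E_V[OF assms(1)] by auto
      then show "T \<in> {T \<in> triangles n S. {a, b} \<subseteq> T}"
        using c ne[OF c(2)] E_V[OF assms(1)] assms(1) unfolding triangles_def
        by (auto simp: insert_commute)
    next
      fix T assume T: "T \<in> {T \<in> triangles n S. {a, b} \<subseteq> T}"
      then have c3: "card T = 3" and abT: "a \<in> T" "b \<in> T" unfolding triangles_def by auto
      have ab: "a \<noteq> b" using E_V[OF assms(1)] by auto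
      have fin: "finite T" using c3 by (metis card.infinite zero_neq_numeral)
      have "card (T - {a, b}) = 1" using c3 abT ab fin by (subst card_Diff_subset) auto
      then obtain c where c: "T - {a, b} = {c}" by (rule card_1_singletonE)
      then have Tc: "T = {a, b, c}" "c \<noteq> a" "c \<noteq> b" using abT by auto
      have cV: "c \<in> vertices n" and e: "{a, c} \<in> E" "{c, b} \<in> E"
        using T Tc unfolding triangles_def by auto
      have "pos n c \<noteq> pos n a" "pos n c \<noteq> pos n b"
        using pos_inj[OF cV] E_V[OF assms(1)] Tc by auto
      then have "c \<in> apexes a b" using e unfolding apexes_def inner_def outer_def by auto
      then show "T \<in> (\<lambda>c. {a, b, c}) ` apexes a b" using Tc by blast
    qed
  qed
  then show ?thesis using bij_betw_same_card by fastforce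
qed

lemma card_apexes:
  assumes "pos n a < pos n b"
  shows "card (apexes a b) = (if \<exists>c. inner a b c then 1 else 0) + (if \<exists>c. outer a b c then 1 else 0)"
proof -
  have i: "{c. inner a b c} = {} \<or> (\<exists>c. {c. inner a b c} = {c})" using inner_unique by blast
  have o: "{c. outer a b c} = {} \<or> (\<exists>c. {c. outer a b c} = {c})"
    using outer_unique assms by blast
  have d: "{c. inner a b c} \<inter> {c. outer a b c} = {}" unfolding inner_def outer_def by auto
  have f: "finite {c. inner a b c}" "finite {c. outer a b c}"
    subgoal using i by (elim disjE exE) simp_all
    subgoal using o by (elim disjE exE) simp_all
    done
  have "card {c. inner a b c} = (if \<exists>c. inner a b c then 1 else 0)" using i by (elim disjE exE) (simp_all add: set_eq_iff)
  moreover have "card {c. outer a b c} = (if \<exists>c. outer a b c then 1 else 0)" using o by (elim disjE exE) (simp_all add: set_eq_iff)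
  ultimately show ?thesis unfolding apexes_def using card_Un_disjoint[OF f d] by simp
qed

lemma no_inner: "pos n b = pos n a + 1 \<Longrightarrow> \<not> inner a b c"
  unfolding inner_def by auto

lemma no_outer:
  assumes "pos n a = 1" "pos n b = 2 * n + 2" shows "\<not> outer a b c"
proof
  assume "outer a b c"
  then show False using assms E_V[of a c] pos_range[of c n] unfolding outer_def by auto
qed

lemma ears_iff_cards:
  "ears \<longleftrightarrow> (\<forall>e\<in>sides n. card {T \<in> triangles n S. e \<subseteq> T} = 1) \<and>
            (\<forall>C\<in>S. card {T \<in> triangles n S. C \<subseteq> T} = 2)"
proof
  assume e: ears
  have inn: "\<exists>c. inner a b c" if "{a, b} \<in> E" "pos n a + 1 < pos n b" for a b
    using e that unfolding ears_def by blast
  show "(\<forall>e\<in>sides n. card {T \<in> triangles n S. e \<subseteq> T} = 1) \<and>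
        (\<forall>C\<in>S. card {T \<in> triangles n S. C \<subseteq> T} = 2)"
  proof (intro conjI ballI)
    fix s assume s: "s \<in> sides n"
    obtain a b where ab: "s = {a, b}" "a \<in> vertices n" "b \<in> vertices n" "pos n a < pos n b"
      using E_obtain[of s] s by blast
    have abE: "{a, b} \<in> E" using s ab by auto
    from s ab side_iff[OF ab(2-4)] consider
      "pos n b = pos n a + 1" "\<not> (pos n a = 1 \<and> pos n b = 2 * n + 2)"
      | "pos n a = 1" "pos n b = 2 * n + 2" using n by auto
    then show "card {T \<in> triangles n S. s \<subseteq> T} = 1"
    proof cases
      case 1
      have "\<exists>c. outer a b c" "\<not> (\<exists>c. inner a b c)"
        using outer_exists[OF e abE ab(4) 1(2)] no_inner[OF 1(1)] by blast+
      then show ?thesis using card_triangles[OF abE ab(4)] card_apexes[OF ab(4)] ab(1) by simp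
    next
      case 2
      have "\<exists>c. inner a b c" "\<not> (\<exists>c. outer a b c)"
        using inn[OF abE] no_outer[OF 2] 2 n by auto
      then show ?thesis using card_triangles[OF abE ab(4)] card_apexes[OF ab(4)] ab(1) by simp
    qed
  next
    fix s assume s: "s \<in> S"
    obtain a b where ab: "s = {a, b}" "a \<in> vertices n" "b \<in> vertices n" "pos n a < pos n b"
      using E_obtain[of s] s by blast
    have abE: "{a, b} \<in> E" using s ab by auto
    have "{a, b} \<notin> sides n" using s ab sub unfolding chords_def by auto
    then have *: "pos n b \<noteq> pos n a + 1" "\<not> (pos n a = 1 \<and> pos n b = 2 * n + 2)"
      using side_iff[OF ab(2-4)] by auto
    have "\<exists>c. inner a b c" "\<exists>c. outer a b c"
      using inn[OF abE] outer_exists[OF e abE ab(4) *(2)] * ab by auto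
    then show "card {T \<in> triangles n S. s \<subseteq> T} = 2"
      using card_triangles[OF abE ab(4)] card_apexes[OF ab(4)] ab(1) by simp
  qed
next
  assume c: "(\<forall>e\<in>sides n. card {T \<in> triangles n S. e \<subseteq> T} = 1) \<and>
             (\<forall>C\<in>S. card {T \<in> triangles n S. C \<subseteq> T} = 2)"
  show ears
    unfolding ears_def
  proof (intro allI impI)
    fix a b assume abE: "{a, b} \<in> E" and l: "pos n a + 1 < pos n b"
    have V: "a \<in> vertices n" "b \<in> vertices n" using E_V[OF abE] by auto
    have lt: "pos n a < pos n b" using l by simp
    show "\<exists>c. inner a b c"
    proof (cases "{a, b} \<in> S")
      case True
      then have "card (apexes a b) = 2" unfolding card_triangles[OF abE lt, symmetric] using c by blast
      then show ?thesis using card_apexes[OF lt] by (cases "\<exists>c. inner a b c") (simp_all split: if_splits)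
    next
      case False
      then have s: "{a, b} \<in> sides n" using abE by simp
      then have "card (apexes a b) = 1" unfolding card_triangles[OF abE lt, symmetric] using c by blast
      moreover have "pos n a = 1" "pos n b = 2 * n + 2" using side_iff[OF V lt] s l by auto
      then have "\<not> (\<exists>c. outer a b c)" using no_outer by blast
      ultimately show ?thesis using card_apexes[OF lt] by (cases "\<exists>c. inner a b c") (simp_all split: if_splits)
    qed
  qed
qed

end

theorem triangulation_iff_maximal:
  assumes "n \<ge> 1"
  shows "triangulation n S \<longleftrightarrow>
     S \<subseteq> chords n \<and> (\<forall>C\<in>S. \<forall>D\<in>S. \<not> crossing n C D) \<and>
     (\<forall>C\<in>chords n - S. \<exists>D\<in>S. crossing n C D)"
proof (cases "S \<subseteq> chords n \<and> (\<forall>C\<in>S. \<forall>D\<in>S. \<not> crossing n C D)")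
  case True
  then interpret noncrossing n S using assms by unfold_locales auto
  show ?thesis
    using True ears_iff_cards maxl_imp_ears ears_imp_maxl
    unfolding triangulation_def maxl_def by blast
next
  case False
  then show ?thesis unfolding triangulation_def by blast
qed

end

(* Let N = n + 1 and number the vertices clockwise 1, ..., 2N, so that the barred vertex j is at N + j.
   A green flip, up to the half-turn, replaces the diagonal {i, k} of a quadrilateral h < i < j < k with
   j > N by {h, j}. It lowers the lowest neighbour of the vertex at j. So let f(j), for 1 <= j <= N, be
   the lowest neighbour of N + j, or j if that neighbour is at or below the antipode j. Flipping upwards
   greedily shows that mapping a triangulation to its f is an order-reversing bijection from the Tamari
   order onto the pointwise order on the vectors f satisfying two simple closure conditions.

   Upper bounds of two such vectors have a least element, obtained by raising the entries of the
   pointwise maximum to the next admissible value; this gives meets, hence a lattice.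
   An element x is left modular if every y < z is separated by an upper bound of x and y not above z, or
   by a lower bound of x and z not below y. The vectors with maximal entries before j, an arbitrary
   entry at j and minimal entries after j have this property: a difference of y and z away from j is
   detected by completing y or z with extreme entries, and a difference at j by a suitable entry there.
   Lowering one entry at a time gives a maximal chain of such vectors. *)
theory Submission
  imports Defs
begin

section \<open>Bracket vectors of symmetric arc diagrams\<close>

text \<open>\<open>w j\<close> encodes the lowest neighbour of the vertex \<open>N + j\<close>; the value \<open>j\<close>, the position of the
  antipode, stands for every neighbour at or below it.\<close>

definition bracket_vector :: "nat \<Rightarrow> (nat \<Rightarrow> nat) \<Rightarrow> bool" where
  "bracket_vector N w \<longleftrightarrow>
     (\<forall>j\<in>{1..N}. j \<le> w j \<and> w j < N + j) \<and> w N = N \<and>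
     (\<forall>j\<in>{1..N}. \<forall>i\<in>{1..<j}. w j \<noteq> j \<longrightarrow> w j < N + i \<longrightarrow> w j \<le> w i) \<and>
     (\<forall>j\<in>{1..N}. w j \<le> N \<longrightarrow> w (w j) = w j)"

text \<open>The edges \<open>{p, q}\<close>, \<open>p < q\<close>, of a centrally symmetric triangulation of a \<open>2 * N\<close>-gon, sides included,
  in terms of the positions \<open>1, \<dots>, 2 * N\<close>; the half-turn is the shift by \<open>N\<close>.\<close>

locale sym_arcs =
  fixes N :: nat and E :: "nat \<Rightarrow> nat \<Rightarrow> bool"
  assumes N: "2 \<le> N"
    and range: "E p q \<Longrightarrow> 1 \<le> p \<and> p < q \<and> q \<le> 2 * N"
    and side: "1 \<le> p \<Longrightarrow> p < 2 * N \<Longrightarrow> E p (Suc p)"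
    and long_side: "E 1 (2 * N)"
    and nc: "E a c \<Longrightarrow> E b d \<Longrightarrow> a < b \<Longrightarrow> b < c \<Longrightarrow> c < d \<Longrightarrow> False"
    and outer: "E a b \<Longrightarrow> a \<noteq> 1 \<or> b \<noteq> 2 * N \<Longrightarrow>
      \<exists>c. c < a \<and> E c a \<and> E c b \<or> b < c \<and> E a c \<and> E b c"
    and maximal: "1 \<le> p \<Longrightarrow> p < q \<Longrightarrow> q \<le> 2 * N \<Longrightarrow> \<not> E p q \<Longrightarrow>
      \<exists>a b. E a b \<and> (a < p \<and> p < b \<and> b < q \<or> p < a \<and> a < q \<and> q < b)"
    and turn_mixed: "E p q \<Longrightarrow> p \<le> N \<Longrightarrow> N < q \<Longrightarrow> E (q - N) (p + N)"
    and turn_unbarred: "E p q \<Longrightarrow> q \<le> N \<Longrightarrow> E (p + N) (q + N)"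
    and turn_barred: "E p q \<Longrightarrow> N < p \<Longrightarrow> E (p - N) (q - N)"
begin

section \<open>The bracket vector of an arc diagram\<close>

definition first :: "nat \<Rightarrow> nat" where
  "first j = (LEAST m. E m (N + j))"

definition bracket :: "nat \<Rightarrow> nat" where
  "bracket j = max j (first j)"

lemma first_arc:
  assumes "1 \<le> j" "j \<le> N"
  shows "E (first j) (N + j)"
proof -
  have "E (N + j - 1) (N + j)" using side[of "N + j - 1"] assms N by simp
  then show ?thesis unfolding first_def by (rule LeastI)
qed

lemma first_le: "E m (N + j) \<Longrightarrow> first j \<le> m"
  unfolding first_def by (rule Least_le)

lemma bracket_le: "E m (N + j) \<Longrightarrow> bracket j \<le> max j m"
  using first_le[of m j] unfolding bracket_def by simp

lemma bracket_ge: "j \<le> bracket j"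
  unfolding bracket_def by simp

lemma bracket_first: "bracket j \<noteq> j \<Longrightarrow> bracket j = first j \<and> j < first j"
  unfolding bracket_def by linarith

lemma bracket_top: "bracket N = N"
  using bracket_le[of 1 N] long_side bracket_ge[of N] N by (simp add: mult_2)

lemma first_bracket:
  assumes j: "j \<in> {1..N}" and b: "bracket j = first j" "j < first j" and le: "bracket j \<le> N"
  shows "bracket (bracket j) = bracket j"
proof -
  define m where "m = bracket j"
  have m: "m = first j" "j < m" "m \<le> N" "1 \<le> j" "j \<le> N" using assms unfolding m_def by auto
  have e: "E m (N + j)" using first_arc m by simp
  obtain t where t: "t < m \<and> E t m \<and> E t (N + j) \<or> N + j < t \<and> E m t \<and> E (N + j) t"
    using outer[OF e] m by auto
  have "\<not> (t < m \<and> E t (N + j))" using first_le[of t j] m by auto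
  then have t: "N + j < t" "E m t" "E (N + j) t" using t by auto
  define s where "s = t - N"
  have s: "t = N + s" "j < s" "s \<le> N" using t range[OF t(2)] unfolding s_def by auto
  have e1: "E s (N + m)" using turn_mixed[OF t(2)] s m by (simp add: add.commute)
  have e2: "E j s" using turn_barred[OF t(3)] s m by simp
  have "\<not> m < s" using nc[OF e2 e] m s by auto
  then show ?thesis using bracket_le[OF e1] bracket_ge[of m] unfolding m_def by simp
qed

text \<open>The condition relating \<open>i < j\<close> comes from the lowest arcs at
  \<open>N + i\<close> and \<open>N + j\<close> not crossing; the fixed point condition is
  \<open>first_bracket\<close>.\<close>

lemma bracket_vector_bracket: "bracket_vector N bracket"
  unfolding bracket_vector_def
proof (intro conjI ballI impI)
  fix j assume j: "j \<in> {1..N}"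
  show "j \<le> bracket j" by (rule bracket_ge)
  have "Suc (N + j - 1) = N + j" using N by simp
  then have "E (N + j - 1) (N + j)" using side[of "N + j - 1"] j N by auto
  then show "bracket j < N + j" using bracket_le[of "N + j - 1" j] j N by simp
  show "bracket j \<le> N \<Longrightarrow> bracket (bracket j) = bracket j"
    using first_bracket[OF j] bracket_first[of j] by (cases "bracket j = j") auto
  fix i assume i: "i \<in> {1..<j}" and b: "bracket j \<noteq> j" "bracket j < N + i"
  have m: "bracket j = first j" "j < first j" using bracket_first[OF b(1)] by auto
  have ij: "first i < first j \<Longrightarrow> False"
    using nc[OF first_arc[of i] first_arc[of j]] i j b m by auto
  then have "first j \<le> first i" by (rule leI[OF notI])
  then show "bracket j \<le> bracket i" using m unfolding bracket_def by linarith
qed (rule bracket_top)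

text \<open>Choosing \<open>j\<close> maximal with \<open>w j < bracket j\<close> makes the chord \<open>{i, k}\<close> above \<open>{i, N + j}\<close> flip upwards
  without dropping the bracket vector below \<open>w\<close>.\<close>

lemma green_step:
  assumes w: "bracket_vector N w" and le: "\<And>j. j \<in> {1..N} \<Longrightarrow> w j \<le> bracket j"
    and ne: "j0 \<in> {1..N}" "w j0 < bracket j0"
  obtains h i j k where "h < i" "i < N + j" "N + j < k" "1 \<le> j" "j \<le> N"
    "E h i" "E i (N + j)" "E (N + j) k" "E h k" "E i k"
    "w j \<le> max j h" "h \<le> N \<Longrightarrow> w h \<le> max h j"
proof -
  have w1: "\<And>j. j \<in> {1..N} \<Longrightarrow> j \<le> w j" and wN: "w N = N"
    and w2: "\<And>j i. j \<in> {1..N} \<Longrightarrow> i \<in> {1..<j} \<Longrightarrow> w j \<noteq> j \<Longrightarrow> w j < N + i \<Longrightarrow> w j \<le> w i"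
    and w3: "\<And>j. j \<in> {1..N} \<Longrightarrow> w j \<le> N \<Longrightarrow> w (w j) = w j"
    using w unfolding bracket_vector_def by auto
  define A where "A = {j \<in> {1..N}. w j < bracket j}"
  have fin: "finite A" "A \<noteq> {}" using ne unfolding A_def by auto
  \<comment> \<open>Maximality makes \<open>w\<close> and \<open>bracket\<close> agree beyond
    \<open>j\<close>, so closure conditions on \<open>w\<close> can be read as statements about arcs
    there and conversely.\<close>
  define j where "j = Max A"
  have jA: "j \<in> A" using Max_in[OF fin] unfolding j_def .
  have jmax: "w x = bracket x" if "j < x" "x \<le> N" for x
  proof -
    have "x \<notin> A" using Max_ge[OF fin(1), of x] that unfolding j_def by auto
    then show ?thesis using that le[of x] jA unfolding A_def by auto
  qed
  have j: "1 \<le> j" "j \<le> N" "w j < bracket j" using jA unfolding A_def by auto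
  define i where "i = bracket j"
  have i: "i = first j" "j < i" "w j < i" using bracket_first[of j] w1[of j] j unfolding i_def by auto
  have ij: "E i (N + j)" using first_arc i j by simp
  have iN: "i < N + j" using range[OF ij] by simp
  obtain k where "k < i \<and> E k i \<and> E k (N + j) \<or> N + j < k \<and> E i k \<and> E (N + j) k"
    using outer[OF ij] i j by auto
  then have k: "N + j < k" "E i k" "E (N + j) k" using first_le[of k j] i by auto
  define s where "s = k - N"
  have s: "k = N + s" "j < s" "s \<le> N" using k range[OF k(2)] unfolding s_def by auto
  have js: "E j s" using turn_barred[OF k(3)] s j by simp
  have si: "s \<le> i" if "i \<le> N"
    using nc[OF js ij i(2)] s j by (cases "i < s") auto
  obtain h where h0: "h < i \<and> E h i \<and> E h k \<or> k < h \<and> E i h \<and> E k h"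
    using outer[OF k(2)] i j by auto
  \<comment> \<open>The other apex over the arc from \<open>i\<close> to \<open>k\<close> lies below
    \<open>i\<close>. If it were above \<open>k\<close>, then for \<open>s < i\<close> the entry
    \<open>w s = bracket s = i\<close> would force \<open>i \<le> w j\<close> by closure, and for
    \<open>s = i\<close> the half-turn of the arc from \<open>i\<close> to \<open>N + j\<close>
    would cross the arc from \<open>i\<close> to \<open>h\<close>.\<close>
  have h: "h < i \<and> E h i \<and> E h k"
  proof (rule ccontr)
    assume "\<not> ?thesis"
    then have h: "k < h" "E i h" "E k h" using h0 by auto
    have hN: "h \<le> 2 * N" using range[OF h(2)] by simp
    show False
    proof (cases "s < i")
      case True
      have "i \<le> first s"
      proof (rule ccontr)
        assume "\<not> i \<le> first s"
        then show False using nc[OF first_arc[of s] h(2)] s h(1) range[OF k(2)] j by auto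
      qed
      then have "bracket s = i" using bracket_le[of i s] k(2) s True unfolding bracket_def by auto
      then have "w s = i" using jmax[of s] s by simp
      then show False using w2[of s j] s j i True ij iN by auto
    next
      case False
      then have eq: "i = s" using si s by auto
      have "E j k" using turn_mixed[OF ij] eq s j by (simp add: add.commute)
      then show False using nc[of j k i h] h range[OF k(2)] i by auto
    qed
  qed
  have h1: "1 \<le> h" using h range by blast
  \<comment> \<open>If \<open>i \<le> N\<close>, a larger \<open>w j\<close> is a fixed point
    between \<open>h\<close> and \<open>i\<close>, and the half-turn of the lowest arc at
    \<open>N + w j\<close> crosses the arc from \<open>h\<close> to \<open>i\<close>. If
    \<open>i > N\<close>, closure bounds \<open>w j\<close> by the entry at \<open>i - N\<close>,
    which the neighbour \<open>h\<close> of \<open>i\<close> bounds in turn.\<close>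
  have wj: "w j \<le> max j h"
  proof (rule ccontr)
    assume "\<not> ?thesis"
    then have m: "j < w j" "h < w j" by auto
    show False
    proof (cases "i \<le> N")
      case True
      have wN: "w j \<le> N" and mi: "w j < i" using True i by auto
      then have wm: "w (w j) = w j" using w3[of j] j by auto
      then have bm: "bracket (w j) = w j" using jmax[of "w j"] m wN by simp
      define x where "x = first (w j)"
      have x: "x \<le> w j" using bm unfolding bracket_def x_def by linarith
      have "E x (N + w j)" unfolding x_def using first_arc m wN j by auto
      then have "E (w j) (x + N)" and "1 \<le> x" using turn_mixed[of x "N + w j"] x wN m range[of x] by auto
      then show False using nc[of h i "w j" "x + N"] h m mi True by auto
    next
      case False
      define i' where "i' = i - N"
      have i': "i = N + i'" "1 \<le> i'" "i' < j" using False iN unfolding i'_def by auto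
      have "w j \<le> w i'" using w2[of j i'] j m i i' by auto
      also have "\<dots> \<le> bracket i'" using le[of i'] i' j by auto
      also have "\<dots> \<le> max i' h" using bracket_le[of h i'] h i' by auto
      finally show False using m i' by auto
    qed
  qed
  \<comment> \<open>The half-turn of the new arc from \<open>h\<close> to \<open>N + j\<close> ends
    at \<open>N + h\<close>, so the entry at \<open>h\<close> may drop too and needs its own
    bound.\<close>
  have wh: "w h \<le> max h j" if hN: "h \<le> N"
  proof (cases "i \<le> N")
    case True
    have "\<not> h < j"
    proof
      assume "h < j"
      moreover have "E j (i + N)" using turn_mixed[OF ij] True j by simp
      ultimately show False using nc[of h i j "i + N"] h i True h1 by auto
    qed
    then consider "h = j" | "j < h" by linarith
    then show ?thesis
    proof cases
      case 1 then show ?thesis using wj by simp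
    next
      case 2
      have "s \<le> h"
        using nc[of j s h k] js h 2 s by (cases "h < s") auto
      moreover have "E s (N + h)" using turn_mixed[of h k] h hN s j by (simp add: add.commute)
      ultimately show ?thesis using bracket_le[of s h] le[of h] h1 hN by auto
    qed
  next
    case False
    define i' where "i' = i - N"
    have i': "i = N + i'" "1 \<le> i'" "i' < j" using False iN unfolding i'_def by auto
    have "E i' (N + h)" using turn_mixed[of h i] h hN i' by (simp add: add.commute)
    then show ?thesis using bracket_le[of i' h] le[of h] h1 hN i' by auto
  qed
  show thesis using that[of h i j k] h iN k j ij wj wh by auto
qed

end

section \<open>Arc diagrams are determined by their bracket vectors\<close>

text \<open>If \<open>N + i \<le> j\<close>, the truncation at the antipode hides the crossing from the coordinate of \<open>j\<close>; it
  is then seen at the coordinate of \<open>N + h\<close> of the half-turned pair.\<close>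

lemma no_red_crossing:
  assumes "sym_arcs N E" "sym_arcs N F"
    and le: "\<And>j. j \<in> {1..N} \<Longrightarrow> sym_arcs.bracket N F j \<le> sym_arcs.bracket N E j"
    and E: "F i k" and F: "E h j" and o: "h < i" "i < j" "j < k" "N < j"
  shows False
proof -
  interpret E: sym_arcs N E by fact
  interpret F: sym_arcs N F by fact
  have kN: "k \<le> 2 * N" and jN: "1 \<le> h" using E.range[OF F] F.range[OF E] by auto
  define j' k' where "j' = j - N" and "k' = k - N"
  have j': "j = N + j'" "1 \<le> j'" "j' \<le> N" using o kN unfolding j'_def by auto
  have k': "k = N + k'" "j' < k'" "k' \<le> N" using o kN j' unfolding k'_def by auto
  have "E.bracket j' \<le> max j' h" using E.bracket_le[of h j'] F j' by simp
  then have "F.bracket j' \<le> max j' h" using le[of j'] j' by simp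
  moreover have "i \<le> F.first j'"
  proof (rule ccontr)
    assume "\<not> ?thesis"
    then show False using F.nc[OF F.first_arc[of j'] E] j' o by auto
  qed
  ultimately have ij: "i \<le> j'" using o unfolding F.bracket_def by auto
  have "E j' (N + h)" using E.turn_mixed[OF F] j' ij o by (simp add: add.commute)
  then have "E.bracket h \<le> j'" using E.bracket_le[of j' h] ij o by simp
  then have "F.bracket h \<le> j'" using le[of h] jN ij o j' by simp
  then have l: "F.first h \<le> j'" unfolding F.bracket_def by simp
  have a: "F k' (N + i)" using F.turn_mixed[OF E] k' ij j' by (simp add: add.commute)
  have b: "F (F.first h) (N + h)" using F.first_arc[of h] jN ij o j' by simp
  show False using F.nc[OF b a] l k' jN o by auto
qed

text \<open>By maximality a missing arc crosses an arc of \<open>E\<close>, and up to the half-turn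
  every crossing is of the kind excluded by \<open>no_red_crossing\<close>.\<close>

lemma bracket_determines_arcs:
  assumes "sym_arcs N E" "sym_arcs N F"
    and eq: "\<And>j. j \<in> {1..N} \<Longrightarrow> sym_arcs.bracket N F j = sym_arcs.bracket N E j"
    and F: "F p q"
  shows "E p q"
proof (rule ccontr)
  assume n: "\<not> E p q"
  have *: False if A: "sym_arcs N A" and B: "sym_arcs N B" and ac: "A a c" and bd: "B b d"
      and eq: "\<And>j. j \<in> {1..N} \<Longrightarrow> sym_arcs.bracket N A j = sym_arcs.bracket N B j"
      and o: "a < b" "b < c" "c < d" for A B a b c d
  proof -
    interpret A: sym_arcs N A by fact
    interpret B: sym_arcs N B by fact
    have r: "1 \<le> a" "c \<le> 2 * N" "d \<le> 2 * N" using A.range[OF ac] B.range[OF bd] by auto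
    consider "N < c" | "d \<le> N" | "c \<le> N" "N < d" by linarith
    then show False
    proof cases
      case 1 then show ?thesis using no_red_crossing[OF A B _ bd ac] o eq by simp
    next
      case 2
      then show ?thesis
        using no_red_crossing[OF A B _ B.turn_unbarred[OF bd] A.turn_unbarred[OF ac]] o eq by simp
    next
      case 3
      \<comment> \<open>Here the half-turn exchanges which of the two arcs is the lower one, so the
        brackets are compared in the opposite direction.\<close>
      have "b \<le> N" "d - N < a + N" "N < b + N" using 3 o r by linarith+
      then show ?thesis
        using no_red_crossing[OF B A _ A.turn_unbarred[OF ac] B.turn_mixed[OF bd]] o eq 3 by simp
    qed
  qed
  have "1 \<le> p" "p < q" "q \<le> 2 * N" using sym_arcs.range[OF assms(2) F] by auto
  then obtain a b where ab: "E a b" "a < p \<and> p < b \<and> b < q \<or> p < a \<and> a < q \<and> q < b"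
    using sym_arcs.maximal[OF assms(1)] n by blast
  then show False using *[OF assms(1,2) ab(1) F] *[OF assms(2,1) F ab(1)] eq by auto
qed

section \<open>Chords by position\<close>

definition vertex_at :: "nat \<Rightarrow> nat \<Rightarrow> vertex" where
  "vertex_at n p = (if p \<le> n + 1 then Unbarred p else Barred (p - (n + 1)))"

definition arc :: "nat \<Rightarrow> vertex set set \<Rightarrow> nat \<Rightarrow> nat \<Rightarrow> bool" where
  "arc n S p q \<longleftrightarrow> 1 \<le> p \<and> p < q \<and> q \<le> 2 * (n + 1) \<and> {vertex_at n p, vertex_at n q} \<in> S \<union> sides n"

lemma pos_vertex_at [simp]: "pos n (vertex_at n p) = p"
  unfolding vertex_at_def by simp

lemma vertex_at_pos: "v \<in> vertices n \<Longrightarrow> vertex_at n (pos n v) = v"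
  unfolding vertex_at_def vertices_def by (cases v) auto

lemma vertex_at_in: "1 \<le> p \<Longrightarrow> p \<le> 2 * (n + 1) \<Longrightarrow> vertex_at n p \<in> vertices n"
  unfolding vertex_at_def vertices_def by auto

lemma vertex_at_eq_iff [simp]: "vertex_at n p = vertex_at n q \<longleftrightarrow> p = q"
  by (metis pos_vertex_at)

lemma half_turn_half_turn [simp]: "half_turn (half_turn v) = v"
  by (cases v) auto

lemma half_turn_image_image [simp]: "half_turn ` half_turn ` A = A"
  by (simp add: image_image)

lemma half_turn_image_eq_iff: "half_turn ` A = B \<longleftrightarrow> A = half_turn ` B"
  by (metis half_turn_image_image)

lemma half_turn_neq [simp]: "half_turn v \<noteq> v"
  by (cases v) auto

lemma half_turn_vertices [simp]: "half_turn v \<in> vertices n \<longleftrightarrow> v \<in> vertices n"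
  unfolding vertices_def by (cases v) auto

lemma half_turn_unbarred: "1 \<le> p \<Longrightarrow> p \<le> n + 1 \<Longrightarrow> half_turn (vertex_at n p) = vertex_at n (p + (n + 1))"
  unfolding vertex_at_def by simp

lemma half_turn_barred: "n + 1 < p \<Longrightarrow> p \<le> 2 * (n + 1) \<Longrightarrow> half_turn (vertex_at n p) = vertex_at n (p - (n + 1))"
  unfolding vertex_at_def by auto

lemma side_vertex_at:
  assumes "1 \<le> n" "1 \<le> p" "p < q" "q \<le> 2 * (n + 1)"
  shows "{vertex_at n p, vertex_at n q} \<in> sides n \<longleftrightarrow> q = Suc p \<or> p = 1 \<and> q = 2 * (n + 1)"
proof -
  \<comment> \<open>The empty set of chords makes the facts about sides available without a
    triangulation.\<close>
  interpret noncrossing n "{}" using assms by unfold_locales auto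
  show ?thesis using side_iff[of "vertex_at n p" "vertex_at n q"] vertex_at_in[of p n] vertex_at_in[of q n] assms by simp
qed

lemma pair_vertex_at:
  assumes "u \<in> vertices n" "v \<in> vertices n" "u \<noteq> v"
  obtains p q where "1 \<le> p" "p < q" "q \<le> 2 * (n + 1)" "{u, v} = {vertex_at n p, vertex_at n q}"
proof -
  consider "pos n u < pos n v" | "pos n v < pos n u"
    using assms pos_inj[of u n v] by linarith
  then show thesis
  proof cases
    case 1
    show ?thesis using that[OF _ 1] pos_range[of u n] pos_range[of v n] assms by (simp add: vertex_at_pos)
  next
    case 2
    show ?thesis using that[OF _ 2] pos_range[of u n] pos_range[of v n] assms
      by (simp add: vertex_at_pos insert_commute)
  qed
qed

lemma chordE:
  assumes "1 \<le> n" "C \<in> chords n"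
  obtains p q where "1 \<le> p" "p < q" "q \<le> 2 * (n + 1)" "C = {vertex_at n p, vertex_at n q}"
    "q \<noteq> Suc p" "\<not> (p = 1 \<and> q = 2 * (n + 1))"
proof -
  obtain u v where "C = {u, v}" "u \<in> vertices n" "v \<in> vertices n" "u \<noteq> v" "C \<notin> sides n"
    using assms unfolding chords_def by blast
  then show thesis using that side_vertex_at[OF assms(1)] by (metis pair_vertex_at)
qed

lemma chord_vertex_at:
  assumes "1 \<le> n" "1 \<le> p" "p < q" "q \<le> 2 * (n + 1)"
  shows "{vertex_at n p, vertex_at n q} \<in> chords n \<longleftrightarrow> \<not> (q = Suc p \<or> p = 1 \<and> q = 2 * (n + 1))"
proof -
  have "\<exists>u v. {vertex_at n p, vertex_at n q} = {u, v} \<and> u \<in> vertices n \<and> v \<in> vertices n \<and> u \<noteq> v"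
    using assms vertex_at_in[of p n] vertex_at_in[of q n]
    by (intro exI[of _ "vertex_at n p"] exI[of _ "vertex_at n q"]) simp
  then have "{vertex_at n p, vertex_at n q} \<in> chords n \<longleftrightarrow> {vertex_at n p, vertex_at n q} \<notin> sides n"
    unfolding chords_def by blast
  then show ?thesis using side_vertex_at[OF assms] by simp
qed

lemma crossing_vertex_at:
  assumes "p < q" "r < s"
  shows "crossing n {vertex_at n p, vertex_at n q} {vertex_at n r, vertex_at n s} \<longleftrightarrow>
    p < r \<and> r < q \<and> q < s \<or> r < p \<and> p < s \<and> s < q"
proof
  assume "crossing n {vertex_at n p, vertex_at n q} {vertex_at n r, vertex_at n s}"
  then show "p < r \<and> r < q \<and> q < s \<or> r < p \<and> p < s \<and> s < q"
    by (rule crossE) (use assms in \<open>auto simp: doubleton_eq_iff\<close>)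
next
  assume "p < r \<and> r < q \<and> q < s \<or> r < p \<and> p < s \<and> s < q"
  then show "crossing n {vertex_at n p, vertex_at n q} {vertex_at n r, vertex_at n s}"
    using crossI by auto
qed

lemma half_turn_sides:
  assumes "1 \<le> n" "e \<in> sides n"
  shows "half_turn ` e \<in> sides n"
proof -
  obtain u v where e: "e = {u, v}" "u \<in> vertices n" "v \<in> vertices n"
    "pos n v = pos n u + 1 \<or> pos n u = 2 * n + 2 \<and> pos n v = 1"
    using assms unfolding sides_def by blast
  have "half_turn ` e = {half_turn u, half_turn v}" using e by simp
  moreover have "pos n (half_turn v) = pos n (half_turn u) + 1 \<or>
      pos n (half_turn u) = 2 * n + 2 \<and> pos n (half_turn v) = 1"
    using e(2-4) by (cases u; cases v) (auto simp: vertices_def)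
  ultimately show ?thesis using e(2,3) unfolding sides_def mem_Collect_eq
    by (intro exI[of _ "half_turn u"] exI[of _ "half_turn v"]) simp
qed

lemma half_turn_chords:
  assumes "1 \<le> n" "C \<in> chords n"
  shows "half_turn ` C \<in> chords n"
proof -
  obtain u v where C: "C = {u, v}" "u \<in> vertices n" "v \<in> vertices n" "u \<noteq> v" "C \<notin> sides n"
    using assms unfolding chords_def by blast
  have "half_turn ` C \<notin> sides n" using half_turn_sides[OF assms(1), of "half_turn ` C"] C(5) by auto
  moreover have "half_turn u \<noteq> half_turn v" using C(4) by (metis half_turn_half_turn)
  ultimately show ?thesis using C(1-3) unfolding chords_def
    by simp (intro exI[of _ "half_turn u"] exI[of _ "half_turn v"], simp)
qed

lemma half_turn_pair:
  assumes "1 \<le> p" "p < q" "q \<le> 2 * (n + 1)"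
  shows "half_turn ` {vertex_at n p, vertex_at n q} =
    (if q \<le> n + 1 then {vertex_at n (p + (n + 1)), vertex_at n (q + (n + 1))}
     else if p \<le> n + 1 then {vertex_at n (q - (n + 1)), vertex_at n (p + (n + 1))}
     else {vertex_at n (p - (n + 1)), vertex_at n (q - (n + 1))})"
  using assms by (auto simp: half_turn_unbarred half_turn_barred)

lemma crossing_half_turn:
  assumes "1 \<le> n" "C \<in> chords n" "D \<in> chords n" "crossing n C D"
  shows "crossing n (half_turn ` C) (half_turn ` D)"
proof -
  obtain p q where C: "1 \<le> p" "p < q" "q \<le> 2 * (n + 1)" "C = {vertex_at n p, vertex_at n q}"
    using chordE assms by metis
  obtain r s where D: "1 \<le> r" "r < s" "s \<le> 2 * (n + 1)" "D = {vertex_at n r, vertex_at n s}"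
    using chordE assms by metis
  have "p < r \<and> r < q \<and> q < s \<or> r < p \<and> p < s \<and> s < q"
    using assms(4) C D crossing_vertex_at by simp
  then show ?thesis unfolding C(4) D(4) half_turn_pair[OF C(1-3)] half_turn_pair[OF D(1-3)]
    using C D by (auto simp: crossing_vertex_at split: if_splits)
qed

lemma crossing_sym: "crossing n C D \<Longrightarrow> crossing n D C"
  by (elim crossE) (auto simp: crossI)

section \<open>Symmetric triangulations as arc diagrams\<close>

lemma TB_D:
  assumes "1 \<le> n" "S \<in> TB n"
  shows "S \<subseteq> chords n" and "C \<in> S \<Longrightarrow> D \<in> S \<Longrightarrow> \<not> crossing n C D"
    and "C \<in> chords n \<Longrightarrow> C \<notin> S \<Longrightarrow> \<exists>D\<in>S. crossing n C D"
    and "half_turn ` C \<in> S \<longleftrightarrow> C \<in> S"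
proof -
  have t: "triangulation n S" and s: "(\<lambda>C. half_turn ` C) ` S = S"
    using assms unfolding TB_def by auto
  note m = t[unfolded triangulation_iff_maximal[OF assms(1)]]
  show "S \<subseteq> chords n" "C \<in> S \<Longrightarrow> D \<in> S \<Longrightarrow> \<not> crossing n C D"
    "C \<in> chords n \<Longrightarrow> C \<notin> S \<Longrightarrow> \<exists>D\<in>S. crossing n C D" using m by auto
  show "half_turn ` C \<in> S \<longleftrightarrow> C \<in> S" using s by (metis half_turn_image_image image_eqI)
qed

text \<open>By \<open>triangulation_iff_maximal\<close>, a flipped or explicitly given set is
  recognised through maximality instead of counting triangles.\<close>

lemma TB_I:
  assumes "1 \<le> n" "S \<subseteq> chords n" "\<And>C D. C \<in> S \<Longrightarrow> D \<in> S \<Longrightarrow> \<not> crossing n C D"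
    and "\<And>C. C \<in> chords n \<Longrightarrow> C \<notin> S \<Longrightarrow> \<exists>D\<in>S. crossing n C D"
    and "\<And>C. C \<in> S \<Longrightarrow> half_turn ` C \<in> S"
  shows "S \<in> TB n"
proof -
  have "triangulation n S" unfolding triangulation_iff_maximal[OF assms(1)] using assms by auto
  moreover have "S \<subseteq> (\<lambda>C. half_turn ` C) ` S"
    using assms(5) by (metis half_turn_image_image image_eqI subsetI)
  ultimately show ?thesis unfolding TB_def using assms(5) by auto
qed

lemma noncrossing_TB: "1 \<le> n \<Longrightarrow> S \<in> TB n \<Longrightarrow> noncrossing n S"
  using TB_D by unfold_locales auto

lemma ears_TB:
  assumes "1 \<le> n" "S \<in> TB n" shows "noncrossing.ears n S"
proof -
  interpret noncrossing n S using assms by (rule noncrossing_TB)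
  show ?thesis by (rule maxl_imp_ears) (use TB_D(3)[OF assms] in \<open>auto simp: maxl_def\<close>)
qed

text \<open>This links the polygon with positions: \<open>outer\<close> is the triangle on the outer
  side of every edge except the long side, \<open>maximal\<close> is maximality of \<open>S\<close>,
  and the three turn laws are symmetry under the half-turn.\<close>

lemma sym_arcs_arc:
  assumes n: "1 \<le> n" and S: "S \<in> TB n"
  shows "sym_arcs (n + 1) (arc n S)"
proof -
  interpret noncrossing n S using noncrossing_TB[OF assms] .
  have E: "half_turn ` e \<in> S \<union> sides n" if "e \<in> S \<union> sides n" for e
    using that half_turn_sides[OF n] TB_D(4)[OF n S] by auto
  have turn: "half_turn ` {vertex_at n p, vertex_at n q} \<in> S \<union> sides n" if "arc n S p q" for p q
    using E that unfolding arc_def by blast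
  show ?thesis
  proof
    show "2 \<le> n + 1" using n by simp
    show "\<And>p q. arc n S p q \<Longrightarrow> 1 \<le> p \<and> p < q \<and> q \<le> 2 * (n + 1)" unfolding arc_def by simp
    show "arc n S p (Suc p)" if "1 \<le> p" "p < 2 * (n + 1)" for p
      unfolding arc_def using that side_vertex_at[OF n, of p "Suc p"] by simp
    show "arc n S 1 (2 * (n + 1))"
      unfolding arc_def using side_vertex_at[OF n, of 1 "2 * (n + 1)"] by simp
    show False if "arc n S a c" "arc n S b d" "a < b" "b < c" "c < d" for a b c d
      using E_nc[of "vertex_at n a" "vertex_at n c" "vertex_at n b" "vertex_at n d"] that
      unfolding arc_def by simp
    show "\<exists>c. c < a \<and> arc n S c a \<and> arc n S c b \<or> b < c \<and> arc n S a c \<and> arc n S b c"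
      if ab: "arc n S a b" "a \<noteq> 1 \<or> b \<noteq> 2 * (n + 1)" for a b
    proof -
      obtain c where c: "outer (vertex_at n a) (vertex_at n b) c"
        using outer_exists[OF ears_TB[OF assms], of "vertex_at n a" "vertex_at n b"] ab
        unfolding arc_def by auto
      then have "c \<in> vertices n" using E_V unfolding outer_def by blast
      then have "1 \<le> pos n c" "pos n c \<le> 2 * n + 2" "vertex_at n (pos n c) = c"
        using pos_range vertex_at_pos by auto
      then have "pos n c < a \<and> arc n S (pos n c) a \<and> arc n S (pos n c) b \<or>
          b < pos n c \<and> arc n S a (pos n c) \<and> arc n S b (pos n c)"
        using c ab unfolding outer_def arc_def by (auto simp: insert_commute)
      then show ?thesis by blast
    qed
    show "\<exists>a b. arc n S a b \<and> (a < p \<and> p < b \<and> b < q \<or> p < a \<and> a < q \<and> q < b)"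
      if pq: "1 \<le> p" "p < q" "q \<le> 2 * (n + 1)" "\<not> arc n S p q" for p q
    proof -
      have "{vertex_at n p, vertex_at n q} \<in> chords n" "{vertex_at n p, vertex_at n q} \<notin> S"
        using pq side_vertex_at[OF n pq(1-3)] chord_vertex_at[OF n pq(1-3)] unfolding arc_def by auto
      then obtain D where D: "D \<in> S" "crossing n {vertex_at n p, vertex_at n q} D"
        using TB_D(3)[OF assms] by blast
      obtain a b where ab: "1 \<le> a" "a < b" "b \<le> 2 * (n + 1)" "D = {vertex_at n a, vertex_at n b}"
        using chordE[OF n, of D] D TB_D(1)[OF assms] by blast
      have "arc n S a b" using ab D unfolding arc_def by simp
      then show ?thesis using D(2) ab crossing_vertex_at pq by auto
    qed
    show "arc n S (q - (n + 1)) (p + (n + 1))" if "arc n S p q" "p \<le> n + 1" "n + 1 < q" for p q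
      using turn[OF that(1)] that half_turn_pair[of p q n] unfolding arc_def by auto
    show "arc n S (p + (n + 1)) (q + (n + 1))" if "arc n S p q" "q \<le> n + 1" for p q
      using turn[OF that(1)] that half_turn_pair[of p q n] unfolding arc_def by auto
    show "arc n S (p - (n + 1)) (q - (n + 1))" if "arc n S p q" "n + 1 < p" for p q
      using turn[OF that(1)] that half_turn_pair[of p q n] unfolding arc_def by auto
  qed
qed

lemma arc_determines:
  assumes n: "1 \<le> n" and S: "S \<subseteq> chords n" and le: "\<And>p q. arc n S p q \<Longrightarrow> arc n T p q"
  shows "S \<subseteq> T"
proof
  fix C assume C: "C \<in> S"
  then have c: "C \<in> chords n" using S by blast
  then obtain p q where pq: "1 \<le> p" "p < q" "q \<le> 2 * (n + 1)" "C = {vertex_at n p, vertex_at n q}"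
    using chordE[OF n] by metis
  then have "arc n T p q" using C by (intro le) (simp add: arc_def)
  then show "C \<in> T" using c pq(4) unfolding arc_def chords_def by auto
qed

definition bracket_of :: "nat \<Rightarrow> vertex set set \<Rightarrow> nat \<Rightarrow> nat" where
  "bracket_of n S = sym_arcs.bracket (n + 1) (arc n S)"

lemma bracket_of_inj:
  assumes n: "1 \<le> n" and S: "S \<in> TB n" "T \<in> TB n"
    and eq: "\<And>j. j \<in> {1..n + 1} \<Longrightarrow> bracket_of n S j = bracket_of n T j"
  shows "S = T"
proof (rule equalityI)
  show "S \<subseteq> T"
    by (rule arc_determines[OF n TB_D(1)[OF n S(1)]])
      (rule bracket_determines_arcs[OF sym_arcs_arc[OF n S(2)] sym_arcs_arc[OF n S(1)]],
       use eq in \<open>simp_all add: bracket_of_def\<close>)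
  show "T \<subseteq> S"
    by (rule arc_determines[OF n TB_D(1)[OF n S(2)]])
      (rule bracket_determines_arcs[OF sym_arcs_arc[OF n S(1)] sym_arcs_arc[OF n S(2)]],
       use eq in \<open>simp_all add: bracket_of_def\<close>)
qed

section \<open>Flips\<close>

text \<open>The last two hypotheses say that, among chords crossing no remaining chord, only
  \<open>D\<close> can cross \<open>C\<close> and only \<open>C\<close> can cross \<open>D\<close>.
  This yields noncrossing and maximality near \<open>C\<close> and \<open>D\<close>; the half-turn
  carries both over to the images.\<close>

lemma exchange_TB:
  assumes n: "1 \<le> n" and S: "S \<in> TB n" and C: "C \<in> S" and D: "D \<in> chords n" and CD: "crossing n C D"
    and cC: "\<And>Y. Y \<in> chords n \<Longrightarrow> Y \<noteq> D \<Longrightarrow> crossing n Y C \<Longrightarrow>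
      \<exists>X\<in>S - {C, half_turn ` C}. crossing n Y X"
    and cD: "\<And>Y. Y \<in> chords n \<Longrightarrow> Y \<noteq> C \<Longrightarrow> crossing n Y D \<Longrightarrow>
      \<exists>X\<in>S - {C, half_turn ` C}. crossing n Y X"
  shows "(S - {C, half_turn ` C}) \<union> {D, half_turn ` D} \<in> TB n" (is "?T \<in> TB n")
proof (rule TB_I[OF n])
  let ?C = "half_turn ` C" and ?D = "half_turn ` D" and ?R = "S - {C, half_turn ` C}"
  note half = half_turn_chords[OF n] and cross = crossing_half_turn[OF n]
  have Sc: "S \<subseteq> chords n" and nc: "\<And>X Y. X \<in> S \<Longrightarrow> Y \<in> S \<Longrightarrow> \<not> crossing n X Y"
    and sym: "\<And>X. half_turn ` X \<in> S \<longleftrightarrow> X \<in> S" using TB_D[OF n S] by auto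
  have C': "?C \<in> S" using sym C by simp
  have R: "half_turn ` X \<in> ?R" if "X \<in> ?R" for X
    using that sym by (auto simp: half_turn_image_eq_iff)
  show "?T \<subseteq> chords n" using Sc D half by auto
  show "half_turn ` X \<in> ?T" if "X \<in> ?T" for X using that R[of X] by auto
  have D1: "\<not> crossing n X D" if "X \<in> S" "X \<noteq> C" for X
    using cD[of X] that Sc nc by blast
  have D2: "\<not> crossing n X ?D" if X: "X \<in> S" "X \<noteq> ?C" for X
  proof
    assume c: "crossing n X ?D"
    have "crossing n (half_turn ` X) D" using cross[OF _ _ c] X Sc D half by auto
    then show False using D1[of "half_turn ` X"] X sym by (simp add: half_turn_image_eq_iff)
  qed
  \<comment> \<open>The new chord might cross its own image. If the image is \<open>C\<close>, then
    \<open>D\<close> is the image of \<open>C\<close> and lies in \<open>S\<close> although it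
    crosses \<open>C\<close>; otherwise the image crosses a remaining chord, against
    \<open>D2\<close>.\<close>
  have D3: "\<not> crossing n ?D D"
  proof
    assume c: "crossing n ?D D"
    show False
    proof (cases "?D = C")
      case True
      then show ?thesis using CD nc[OF C C'] by (auto simp: half_turn_image_eq_iff)
    next
      case False
      then obtain X where X: "X \<in> ?R" "crossing n ?D X" using cD[OF half[OF D] _ c] by blast
      then show ?thesis using D2[of X] crossing_sym by blast
    qed
  qed
  have irr: "\<not> crossing n X X" if "X \<in> chords n" for X
    using chordE[OF n that] crossing_vertex_at by (metis less_irrefl)
  show "\<not> crossing n X Y" if XY: "X \<in> ?T" "Y \<in> ?T" for X Y
  proof
    assume c: "crossing n X Y"
    note c' = crossing_sym[OF c]
    consider "X \<in> ?R" "Y \<in> ?R" | "X \<in> ?R" "Y = D \<or> Y = ?D" | "X = D \<or> X = ?D" "Y \<in> ?R"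
      | "X = D \<or> X = ?D" "Y = D \<or> Y = ?D"
      using XY unfolding Un_iff[of _ ?R] insert_iff[of _ D] singleton_iff by argo
    then show False
    proof cases
      case 1 then show ?thesis using nc c by simp
    next
      case 2 then show ?thesis using D1[of X] D2[of X] c by auto
    next
      case 3 then show ?thesis using D1[of Y] D2[of Y] c' by auto
    next
      case 4 then show ?thesis using D3 irr[OF D] irr[OF half[OF D]] c c' by auto
    qed
  qed
  show "\<exists>X\<in>?T. crossing n Y X" if Y: "Y \<in> chords n" "Y \<notin> ?T" for Y
  proof -
    have YD: "Y \<noteq> D" "half_turn ` Y \<noteq> D" using Y by (auto simp: half_turn_image_eq_iff)
    consider "Y = C" | "Y = ?C" | "Y \<notin> S" using Y by blast
    then show ?thesis
    proof cases
      case 1 then show ?thesis using CD by blast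
    next
      case 2 then show ?thesis using cross[OF _ D CD] C Sc by blast
    next
      case 3
      then obtain X where X: "X \<in> S" "crossing n Y X" using TB_D(3)[OF n S Y(1)] by blast
      consider "X \<in> ?R" | "X = C" | "X = ?C" using X by blast
      then show ?thesis
      proof cases
        case 1 then show ?thesis using X by blast
      next
        case 2 then show ?thesis using cC[OF Y(1) YD(1)] X by blast
      next
        case 3
        have "crossing n (half_turn ` Y) C" using cross[OF Y(1) _ X(2)] 3 X Sc by auto
        then obtain Z where Z: "Z \<in> ?R" "crossing n (half_turn ` Y) Z"
          using cC[OF half[OF Y(1)] YD(2)] by blast
        have "crossing n Y (half_turn ` Z)" using cross[OF half[OF Y(1)] _ Z(2)] Z(1) Sc by auto
        then show ?thesis using R[OF Z(1)] by blast
      qed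
    qed
  qed
qed

section \<open>Quadrilaterals and the exchange of their diagonals\<close>

lemma (in noncrossing) quad_eq:
  assumes ab: "{a, b} \<in> E" "pos n a < pos n b" and c: "inner a b c" "outer a b d"
  shows "quad n S {a, b} = {a, b, c, d}"
proof -
  have V: "a \<in> vertices n" "b \<in> vertices n" "a \<noteq> b" using E_V[OF ab(1)] by auto
  have apex: "x \<in> {c, d}" if x: "x \<in> vertices n" "x \<noteq> a" "x \<noteq> b" "{a, x} \<in> E" "{x, b} \<in> E" for x
  proof -
    have "pos n x \<noteq> pos n a" "pos n x \<noteq> pos n b" using pos_inj V x by auto
    then have "inner a b x \<or> outer a b x" using x(4,5) unfolding inner_def outer_def by auto
    then show ?thesis using inner_unique c outer_unique ab by blast
  qed
  have T: "{a, b, x} \<in> triangles n S" if x: "inner a b x \<or> outer a b x" for x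
  proof -
    have e: "{a, x} \<in> E" "{x, b} \<in> E" using x unfolding inner_def outer_def by auto
    then have "x \<in> vertices n" "x \<noteq> a" "x \<noteq> b" using E_V by blast+
    then show ?thesis using e V ab unfolding triangles_def by (auto simp: insert_commute)
  qed
  show ?thesis
  proof (rule equalityI)
    show "quad n S {a, b} \<subseteq> {a, b, c, d}"
    proof
      fix x assume "x \<in> quad n S {a, b}"
      then obtain T where T: "T \<in> triangles n S" "a \<in> T" "b \<in> T" "x \<in> T"
        unfolding quad_def by auto
      show "x \<in> {a, b, c, d}"
      proof (cases "x = a \<or> x = b")
        case False
        then show ?thesis using apex[of x] T unfolding triangles_def by auto
      qed auto
    qed
    have "{a, b, c} \<subseteq> quad n S {a, b}" "{a, b, d} \<subseteq> quad n S {a, b}"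
      using T[of c] T[of d] c unfolding quad_def by blast+
    then show "{a, b, c, d} \<subseteq> quad n S {a, b}" by auto
  qed
qed

lemma half_turn_triangles:
  assumes "1 \<le> n" "S \<in> TB n" "T \<in> triangles n S"
  shows "half_turn ` T \<in> triangles n S"
proof -
  have inj: "inj_on half_turn T" by (metis half_turn_half_turn inj_onI)
  have E: "{half_turn u, half_turn v} \<in> S \<union> sides n" if "{u, v} \<in> S \<union> sides n" for u v
    using that TB_D(4)[OF assms(1,2), of "{u, v}"] half_turn_sides[OF assms(1), of "{u, v}"] by auto
  have "\<forall>u\<in>half_turn ` T. \<forall>v\<in>half_turn ` T. u \<noteq> v \<longrightarrow> {u, v} \<in> S \<union> sides n"
  proof (intro ballI impI)
    fix u v assume "u \<in> half_turn ` T" "v \<in> half_turn ` T" "u \<noteq> v"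
    then obtain u' v' where uv: "u' \<in> T" "v' \<in> T" "u' \<noteq> v'" "u = half_turn u'" "v = half_turn v'" by auto
    then have "{u', v'} \<in> S \<union> sides n" using assms(3) unfolding triangles_def by blast
    then show "{u, v} \<in> S \<union> sides n" unfolding uv by (rule E)
  qed
  then show ?thesis using assms(3) card_image[OF inj] unfolding triangles_def by auto
qed

lemma quad_half_turn:
  assumes "1 \<le> n" "S \<in> TB n"
  shows "quad n S (half_turn ` C) = half_turn ` quad n S C"
proof -
  have *: "half_turn ` quad n S C \<subseteq> quad n S (half_turn ` C)" for C
    unfolding quad_def using half_turn_triangles[OF assms] by fastforce
  have "quad n S (half_turn ` C) = half_turn ` half_turn ` quad n S (half_turn ` C)" by simp
  also have "\<dots> \<subseteq> half_turn ` quad n S C"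
    using *[of "half_turn ` C"] by (intro image_mono) simp
  finally show ?thesis using *[of C] by blast
qed

text \<open>A common endpoint forces \<open>C\<close> to be a diameter. Hence an edge of a
  quadrilateral, which meets the diagonal \<open>C\<close> in a vertex, is never the image of
  \<open>C\<close>.\<close>

lemma half_turn_fixed_chord:
  assumes "C = {a, b}" "u \<in> C" "u \<in> half_turn ` C"
  shows "half_turn ` C = C"
proof -
  have "half_turn u \<in> C" using assms(3) by auto
  then have "C = {u, half_turn u}" using assms(1,2) half_turn_neq[of u, symmetric] by auto
  then show ?thesis by auto
qed

text \<open>A chord through the interior of a convex quadrilateral that crosses none of the four
  edges runs from vertex to vertex; crossing one diagonal then makes it the other one.\<close>

lemma crosses_quadrilateral_nat:
  fixes a b c d p q :: nat
  assumes o: "a < b" "b < c" "c < d" "p < q"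
    and ab: "\<not> (p < a \<and> a < q \<and> q < b \<or> a < p \<and> p < b \<and> b < q)"
    and bc: "\<not> (p < b \<and> b < q \<and> q < c \<or> b < p \<and> p < c \<and> c < q)"
    and cd: "\<not> (p < c \<and> c < q \<and> q < d \<or> c < p \<and> p < d \<and> d < q)"
    and ad: "\<not> (p < a \<and> a < q \<and> q < d \<or> a < p \<and> p < d \<and> d < q)"
  shows "p < a \<and> a < q \<and> q < c \<or> a < p \<and> p < c \<and> c < q \<Longrightarrow> p = b \<and> q = d"
    and "p < b \<and> b < q \<and> q < d \<or> b < p \<and> p < d \<and> d < q \<Longrightarrow> p = a \<and> q = c"
proof -
  assume "p < a \<and> a < q \<and> q < c \<or> a < p \<and> p < c \<and> c < q"
  then show "p = b \<and> q = d"
  proof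
    assume 1: "p < a \<and> a < q \<and> q < c"
    then have "q < d" using o by linarith
    then show ?thesis using ad 1 by blast
  next
    assume 1: "a < p \<and> p < c \<and> c < q"
    then have "b < q" "p < d" using o by linarith+
    then have "\<not> p < b" "\<not> b < p" "\<not> q < d" "\<not> d < q" using ab bc cd ad 1 by blast+
    then show ?thesis by simp
  qed
next
  assume "p < b \<and> b < q \<and> q < d \<or> b < p \<and> p < d \<and> d < q"
  then show "p = a \<and> q = c"
  proof
    assume 1: "p < b \<and> b < q \<and> q < d"
    then have "a < q" "p < c" using o by linarith+
    then have "\<not> p < a" "\<not> a < p" "\<not> q < c" "\<not> c < q" using ab bc cd ad 1 by blast+
    then show ?thesis by simp
  next
    assume 1: "b < p \<and> p < d \<and> d < q"
    then have "a < p" using o by linarith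
    then show ?thesis using ad 1 by blast
  qed
qed

text \<open>It is left open which of the diagonals \<open>a c\<close> and \<open>b d\<close> belongs
  to \<open>S\<close>, so both directions of a flip are treated together.\<close>

locale quadrilateral =
  fixes n S a b c d
  assumes n: "1 \<le> n" and S: "S \<in> TB n"
    and arcs: "arc n S a b" "arc n S b c" "arc n S c d" "arc n S a d"
begin

abbreviation "v \<equiv> vertex_at n"

lemma order: "1 \<le> a" "a < b" "b < c" "c < d" "d \<le> 2 * (n + 1)"
  using arcs unfolding arc_def by auto

lemma diagonals: "{v a, v c} \<in> chords n" "{v b, v d} \<in> chords n"
  using order n by (auto simp: chord_vertex_at)

lemma E: "{v a, v b} \<in> S \<union> sides n" "{v b, v c} \<in> S \<union> sides n" "{v c, v d} \<in> S \<union> sides n"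
    "{v a, v d} \<in> S \<union> sides n"
  using arcs unfolding arc_def by auto

lemma quad: "{v a, v c} \<in> S \<Longrightarrow> quad n S {v a, v c} = {v a, v b, v c, v d}"
    "{v b, v d} \<in> S \<Longrightarrow> quad n S {v b, v d} = {v a, v b, v c, v d}"
proof -
  interpret noncrossing n S using noncrossing_TB[OF n S] .
  show "quad n S {v a, v c} = {v a, v b, v c, v d}" if "{v a, v c} \<in> S"
    using quad_eq[of "v a" "v c" "v b" "v d"] that E order
    unfolding inner_def outer_def by (auto simp: insert_commute)
  show "quad n S {v b, v d} = {v a, v b, v c, v d}" if "{v b, v d} \<in> S"
    using quad_eq[of "v b" "v d" "v c" "v a"] that E order
    unfolding inner_def outer_def by (auto simp: insert_commute)
qed

lemma flip_eq:
  assumes "C \<in> S" "(C, D) \<in> {({v a, v c}, {v b, v d}), ({v b, v d}, {v a, v c})}"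
  shows "flip n S C = (S - {C, half_turn ` C}) \<union> {D, half_turn ` D}"
proof -
  have "quad n S C = {v a, v b, v c, v d}" using assms quad by auto
  then have q: "quad n S C - C = D" using assms order by auto
  have "quad n S (half_turn ` C) - half_turn ` C = half_turn ` (quad n S C - C)"
    unfolding quad_half_turn[OF n S]
    by (rule image_set_diff[symmetric]) (metis half_turn_half_turn injI)
  then show ?thesis unfolding flip_def q by simp
qed

text \<open>By \<open>crosses_quadrilateral_nat\<close>, a chord that crosses one diagonal and is
  not the other one crosses an edge of the quadrilateral. That edge remains after the flip, as
  \<open>exchange_TB\<close> requires.\<close>

lemma flip_TB:
  assumes C: "C \<in> S" and D: "(C, D) \<in> {({v a, v c}, {v b, v d}), ({v b, v d}, {v a, v c})}"
  shows "flip n S C \<in> TB n" "D \<in> flip n S C" "D \<notin> S"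
proof -
  have X: "crossing n {v a, v c} {v b, v d}" "crossing n {v b, v d} {v a, v c}"
    using order by (simp_all add: crossing_vertex_at)
  have CD: "crossing n C D" "D \<in> chords n" using X D diagonals by auto
  \<comment> \<open>A crossed edge is not a side of the polygon, hence in \<open>S\<close>. It
    shares a vertex with \<open>C\<close>, so it could be the image of \<open>C\<close> only if
    \<open>C\<close> were its own image.\<close>
  have mem: "{v x, v y} \<in> S - {C, half_turn ` C}"
    if "(x, y) \<in> {(a, b), (b, c), (c, d), (a, d)}"
      "Y \<in> chords n" "crossing n Y {v x, v y}" for x y Y
  proof -
    have o: "1 \<le> x" "x < y" "y \<le> 2 * (n + 1)" using that(1) order by auto
    have "\<not> crossing n Y {v x, v y}" if "{v x, v y} \<in> sides n"
    proof -
      obtain p q where "1 \<le> p" "p < q" "q \<le> 2 * (n + 1)" "Y = {v p, v q}"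
        using chordE[OF n \<open>Y \<in> chords n\<close>] by metis
      then show ?thesis using that side_vertex_at[OF n o] o crossing_vertex_at[of p q x y n] by auto
    qed
    then have S: "{v x, v y} \<in> S" using that E by auto
    have one: "{v x, v y} \<noteq> C" "{v x, v y} \<inter> C \<noteq> {}"
      using that(1) D order by (auto simp: doubleton_eq_iff)
    have "{v x, v y} \<noteq> half_turn ` C"
    proof
      assume e: "{v x, v y} = half_turn ` C"
      obtain u where "u \<in> C" "u \<in> half_turn ` C" using one(2) unfolding e by blast
      moreover obtain p q where "C = {p, q}" using D by auto
      ultimately have "half_turn ` C = C" by (metis half_turn_fixed_chord)
      then show False using e one by simp
    qed
    then show ?thesis using S one by blast
  qed
  have cr: "\<exists>X\<in>S - {C, half_turn ` C}. crossing n Y X"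
    if Y: "Y \<in> chords n" and Y': "crossing n Y {v a, v c} \<and> Y \<noteq> {v b, v d} \<or> crossing n Y {v b, v d} \<and> Y \<noteq> {v a, v c}" for Y
  proof -
    obtain p q where pq: "p < q" "Y = {v p, v q}" using chordE[OF n Y] by metis
    have "\<exists>(x, y)\<in>{(a, b), (b, c), (c, d), (a, d)}. crossing n Y {v x, v y}"
    proof (rule ccontr)
      assume "\<not> ?thesis"
      then have no: "\<not> crossing n Y {v a, v b}" "\<not> crossing n Y {v b, v c}"
        "\<not> crossing n Y {v c, v d}" "\<not> crossing n Y {v a, v d}" by auto
      have ac: "a < c" "b < d" "a < d" using order by auto
      note no' = no[unfolded pq(2), unfolded crossing_vertex_at[OF pq(1) order(2)]
          crossing_vertex_at[OF pq(1) order(3)] crossing_vertex_at[OF pq(1) order(4)]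
          crossing_vertex_at[OF pq(1) ac(3)]]
      note nat = crosses_quadrilateral_nat[OF order(2-4) pq(1) no']
      from Y' show False
      proof (elim disjE conjE)
        assume "crossing n Y {v a, v c}" "Y \<noteq> {v b, v d}"
        then show False using nat(1) unfolding pq(2) crossing_vertex_at[OF pq(1) ac(1)] by blast
      next
        assume "crossing n Y {v b, v d}" "Y \<noteq> {v a, v c}"
        then show False using nat(2) unfolding pq(2) crossing_vertex_at[OF pq(1) ac(2)] by blast
      qed
    qed
    then obtain x y where xy: "(x, y) \<in> {(a, b), (b, c), (c, d), (a, d)}" "crossing n Y {v x, v y}"
      by (elim bexE) (simp split: prod.splits)
    show ?thesis by (rule bexI[of _ "{v x, v y}"], rule xy(2), rule mem[OF xy(1) Y xy(2)])
  qed
  show "flip n S C \<in> TB n" unfolding flip_eq[OF C D]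
    by (rule exchange_TB[OF n S C CD(2,1)]; rule cr) (use D in auto)
  show "D \<in> flip n S C" unfolding flip_eq[OF C D] by simp
  show "D \<notin> S" using TB_D(2)[OF n S C] CD by auto
qed

end

text \<open>The outer apex over \<open>C\<close> decides which diagonal \<open>C\<close> is: an apex
  below both endpoints makes it \<open>b d\<close>, one above both makes it
  \<open>a c\<close>.\<close>

lemma quadrilateral_exists:
  assumes n: "1 \<le> n" and S: "S \<in> TB n" and C: "C \<in> S"
  obtains a b c d where "quadrilateral n S a b c d"
    "C = {vertex_at n a, vertex_at n c} \<or> C = {vertex_at n b, vertex_at n d}"
proof -
  interpret noncrossing n S using noncrossing_TB[OF n S] .
  interpret A: sym_arcs "n + 1" "arc n S" using sym_arcs_arc[OF n S] .
  obtain p q where pq: "1 \<le> p" "p < q" "q \<le> 2 * (n + 1)" "C = {vertex_at n p, vertex_at n q}"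
    "q \<noteq> Suc p" "\<not> (p = 1 \<and> q = 2 * (n + 1))" using chordE[OF n] TB_D(1)[OF n S] C by blast
  have e: "{vertex_at n p, vertex_at n q} \<in> E" "arc n S p q" using pq C unfolding arc_def by auto
  obtain x where x: "inner (vertex_at n p) (vertex_at n q) x"
    using ears_TB[OF n S] e(1) pq unfolding ears_def by fastforce
  then have "x \<in> vertices n" "p < pos n x" "pos n x < q"
    using E_V[of _ x] unfolding inner_def by auto
  then have r: "p < pos n x" "pos n x < q" "arc n S p (pos n x)" "arc n S (pos n x) q"
    using x pq vertex_at_pos unfolding arc_def inner_def by auto
  obtain y where "y < p \<and> arc n S y p \<and> arc n S y q \<or> q < y \<and> arc n S p y \<and> arc n S q y"
    using A.outer[OF e(2)] pq by blast
  then show thesis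
  proof
    assume "y < p \<and> arc n S y p \<and> arc n S y q"
    then have "quadrilateral n S y p (pos n x) q" using n S r by (intro quadrilateral.intro) auto
    then show thesis by (rule that) (use pq(4) in simp)
  next
    assume "q < y \<and> arc n S p y \<and> arc n S q y"
    then have "quadrilateral n S p (pos n x) q y" using n S r by (intro quadrilateral.intro) auto
    then show thesis by (rule that) (use pq(4) in simp)
  qed
qed

section \<open>Green and red diagonals\<close>

lemma pure_pair: "pure {u, v} \<longleftrightarrow> barred u = barred v"
  unfolding pure_def by auto

lemma barred_vertex_at [simp]: "barred (vertex_at n p) \<longleftrightarrow> n + 1 < p"
  unfolding vertex_at_def by auto

lemma label_vertex_at: "label (vertex_at n p) = (if p \<le> n + 1 then p else p - (n + 1))"
  unfolding vertex_at_def by auto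

text \<open>Among the barred vertices \<open>d\<close> has the highest label. If \<open>b\<close> is
  unbarred, the only other unbarred vertex is \<open>a\<close>, whose label is lower. So no vertex
  outranks an endpoint in the way a red chord requires.\<close>

lemma (in quadrilateral) green_higher_diagonal:
  assumes S: "{v b, v d} \<in> S" and c: "n + 1 < c"
  shows "green n S {v b, v d}"
proof -
  have d: "n + 1 < d" using c order by linarith
  have le_d: "\<not> label (v d) < label w" if w: "w \<in> quad n S {v b, v d}" "barred w = barred (v d)" for w
  proof -
    consider "w = v a" | "w = v b" | "w = v c" | "w = v d" using w(1) unfolding quad(2)[OF S] by blast
    then show ?thesis using w(2) order c d by cases (simp_all add: label_vertex_at)
  qed
  have le_b: "\<not> label (v b) < label w"
    if w: "w \<in> quad n S {v b, v d}" "barred w = barred (v b)" "\<not> pure {v b, v d}" for w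
  proof -
    have "b \<le> n + 1" using w(3) d by (auto simp: pure_pair)
    consider "w = v a" | "w = v b" | "w = v c" | "w = v d" using w(1) unfolding quad(2)[OF S] by blast
    then show ?thesis using w(2) order c d \<open>b \<le> n + 1\<close> by cases (simp_all add: label_vertex_at)
  qed
  show ?thesis
  proof (cases "pure {v b, v d}")
    case True
    then show ?thesis using le_d unfolding green_def red_def by auto
  next
    case False
    then show ?thesis using le_d le_b unfolding green_def red_def by auto
  qed
qed

text \<open>The vertex that makes \<open>b d\<close> red is \<open>c\<close>, the one that makes
  \<open>a c\<close> red is \<open>d\<close>. The diagonals not covered here are those which the
  half-turn, if necessary, brings into the form of \<open>green_higher_diagonal\<close>.\<close>

lemma (in quadrilateral) red_cases:
  shows "{v b, v d} \<in> S \<Longrightarrow> c \<le> n + 1 \<Longrightarrow> n + 1 < d \<Longrightarrow> red n S {v b, v d}"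
    and "{v a, v c} \<in> S \<Longrightarrow> n + 1 < c \<or> d \<le> n + 1 \<Longrightarrow> red n S {v a, v c}"
proof -
  assume S: "{v b, v d} \<in> S" and c: "c \<le> n + 1" "n + 1 < d"
  have b: "b \<le> n + 1" using order c by linarith
  have "\<not> pure {v b, v d}" using b c by (simp add: pure_pair)
  moreover have "v c \<in> quad n S {v b, v d}" using quad(2)[OF S] by simp
  moreover have "barred (v c) = barred (v b) \<and> label (v c) > label (v b)"
    using b c order by (simp add: label_vertex_at)
  ultimately show "red n S {v b, v d}" unfolding red_def
    by (simp only: if_False) (intro bexI[of _ "v c"] bexI[of _ "v b"], simp_all)
next
  assume S: "{v a, v c} \<in> S" and c: "n + 1 < c \<or> d \<le> n + 1"
  have "v d \<in> quad n S {v a, v c}" using quad(1)[OF S] by simp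
  moreover have "barred (v d) = barred (v c) \<and> label (v d) > label (v c)"
    using c order by (auto simp: label_vertex_at)
  moreover have "label (v a) < label (v c)" if "pure {v a, v c}"
    using that order by (auto simp: pure_pair label_vertex_at)
  moreover have "barred (v a) = barred (v c)" if "pure {v a, v c}"
    using that unfolding pure_def by blast
  ultimately have "v d \<in> quad n S {v a, v c}" "barred (v d) = barred (v c)" "label (v c) < label (v d)"
    "pure {v a, v c} \<Longrightarrow> barred (v d) = barred (v a) \<and> label (v a) < label (v d)"
    by auto
  then show "red n S {v a, v c}" unfolding red_def by (metis insert_iff singletonD)
qed

text \<open>A green \<open>a c\<close> has \<open>c\<close> unbarred and \<open>d\<close> barred;
  the half-turn then moves \<open>d\<close> to the lowest position and turns \<open>a c\<close> into
  the higher diagonal. A green \<open>b d\<close> with unbarred \<open>c\<close> has only unbarred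
  vertices around it and is shifted as a whole.\<close>

lemma green_cases:
  assumes n: "1 \<le> n" and S: "S \<in> TB n" and C: "C \<in> S" and g: "green n S C"
  obtains h i j k C' where "quadrilateral n S h i j k" "n + 1 < j" "C' = {vertex_at n i, vertex_at n k}"
    "C' = C \<or> C' = half_turn ` C"
proof -
  interpret A: sym_arcs "n + 1" "arc n S" using sym_arcs_arc[OF n S] .
  obtain a b c d where q: "quadrilateral n S a b c d"
    and C': "C = {vertex_at n a, vertex_at n c} \<or> C = {vertex_at n b, vertex_at n d}"
    using quadrilateral_exists[OF n S C] .
  interpret quadrilateral n S a b c d by fact
  from C' show thesis
  proof
    assume ac: "C = {v a, v c}"
    then have c: "c \<le> n + 1" "n + 1 < d" using red_cases(2) C g unfolding green_def by force+
    have "quadrilateral n S (d - (n + 1)) (a + (n + 1)) (b + (n + 1)) (c + (n + 1))"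
      using n S A.turn_mixed[OF arcs(4)] A.turn_unbarred[OF arcs(1)] A.turn_unbarred[OF arcs(2)]
        A.turn_mixed[OF arcs(3)] c order by (auto intro!: quadrilateral.intro)
    moreover have "half_turn ` C = {v (a + (n + 1)), v (c + (n + 1))}"
      unfolding ac using half_turn_pair[of a c n] c order by simp
    ultimately show thesis using that order by auto
  next
    assume bd: "C = {v b, v d}"
    show thesis
    proof (cases "n + 1 < c")
      case True then show ?thesis using that q bd by blast
    next
      case False
      then have d: "d \<le> n + 1" using red_cases(1) bd C g unfolding green_def by force
      have "quadrilateral n S (a + (n + 1)) (b + (n + 1)) (c + (n + 1)) (d + (n + 1))"
        using n S A.turn_unbarred arcs d order by (auto intro!: quadrilateral.intro)
      moreover have "half_turn ` C = {v (b + (n + 1)), v (d + (n + 1))}"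
        unfolding bd using half_turn_pair[of b d n] d order by simp
      ultimately show thesis using that order by auto
    qed
  qed
qed

section \<open>The effect of a flip on the bracket vector\<close>

lemma flip_half_turn: "flip n S (half_turn ` C) = flip n S C"
  unfolding flip_def by auto

text \<open>Only arcs with a barred upper end enter the bracket vector. The image of a diagonal with
  barred upper end is such an arc just when its lower end is unbarred, whence the conditions on
  \<open>a\<close> and \<open>b\<close>.\<close>

lemma (in quadrilateral) flip_arcs:
  assumes bd: "{v b, v d} \<in> S" and c: "n + 1 < c"
  shows "arc n (flip n S {v b, v d}) p q \<Longrightarrow> n + 1 < q \<Longrightarrow>
      arc n S p q \<or> (p, q) = (a, c) \<or> a \<le> n + 1 \<and> (p, q) = (c - (n + 1), a + (n + 1))"
    and "arc n S p q \<Longrightarrow> n + 1 < q \<Longrightarrow>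
      arc n (flip n S {v b, v d}) p q \<or> (p, q) = (b, d) \<or>
      b \<le> n + 1 \<and> (p, q) = (d - (n + 1), b + (n + 1))"
proof -
  have T: "flip n S {v b, v d} =
    (S - {{v b, v d}, half_turn ` {v b, v d}}) \<union> {{v a, v c}, half_turn ` {v a, v c}}"
    by (rule flip_eq) (use bd in auto)
  have half: "half_turn ` {v a, v c} = (if a \<le> n + 1 then {v (c - (n + 1)), v (a + (n + 1))}
      else {v (a - (n + 1)), v (c - (n + 1))})"
    "half_turn ` {v b, v d} = (if b \<le> n + 1 then {v (d - (n + 1)), v (b + (n + 1))}
      else {v (b - (n + 1)), v (d - (n + 1))})"
    using half_turn_pair[of a c n] half_turn_pair[of b d n] order c by auto
  have pair: "{v p, v q} = {v r, v s} \<longleftrightarrow> p = r \<and> q = s" if "p < q" "r < s" for r s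
    using that by (auto simp: doubleton_eq_iff)
  have o: "a < c" "b < d" "c - (n + 1) < a + (n + 1)" "d - (n + 1) < b + (n + 1)"
    "a - (n + 1) < c - (n + 1)" "b - (n + 1) < d - (n + 1)" "\<not> n + 1 < c - (n + 1)" "\<not> n + 1 < d - (n + 1)"
    using order c by auto
  show "arc n S p q \<or> (p, q) = (a, c) \<or> a \<le> n + 1 \<and> (p, q) = (c - (n + 1), a + (n + 1))"
    if pq: "arc n (flip n S {v b, v d}) p q" "n + 1 < q"
  proof -
    have r: "1 \<le> p" "p < q" "q \<le> 2 * (n + 1)" using pq unfolding arc_def by auto
    have "{v p, v q} \<in> S \<union> sides n \<or> {v p, v q} = {v a, v c} \<or> {v p, v q} = half_turn ` {v a, v c}"
      using pq(1) unfolding T arc_def by blast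
    then show ?thesis unfolding half arc_def using r o pq(2)
      by (elim disjE) (simp_all only: pair if_split simp_thms prod.inject split: if_splits, blast+)
  qed
  show "arc n (flip n S {v b, v d}) p q \<or> (p, q) = (b, d) \<or>
      b \<le> n + 1 \<and> (p, q) = (d - (n + 1), b + (n + 1))"
    if pq: "arc n S p q" "n + 1 < q"
  proof -
    have r: "1 \<le> p" "p < q" "q \<le> 2 * (n + 1)" using pq unfolding arc_def by auto
    have "{v p, v q} \<in> flip n S {v b, v d} \<union> sides n \<or> {v p, v q} = {v b, v d} \<or> {v p, v q} = half_turn ` {v b, v d}"
      using pq(1) unfolding T arc_def by blast
    then show ?thesis unfolding half arc_def using r o pq(2)
      by (elim disjE) (simp_all only: pair if_split simp_thms prod.inject split: if_splits, blast+)
  qed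
qed

text \<open>No removed arc is the lowest at its upper end: \<open>k\<close> has the neighbour
  \<open>h\<close> below \<open>i\<close>, and the half-turn of the edge from \<open>i\<close> to
  \<open>j\<close> lies below that of the diagonal from \<open>i\<close> to \<open>k\<close>. So the
  lowest arc at \<open>n + 1 + s\<close> survives, and the minimum can only decrease.\<close>

lemma flip_cover_bracket_le:
  assumes n: "1 \<le> n" and ST: "flip_cover n S T" and s: "s \<in> {1..n + 1}"
  shows "bracket_of n T s \<le> bracket_of n S s"
proof -
  obtain C where S: "S \<in> TB n" "T \<in> TB n" and C: "C \<in> S" "green n S C" "T = flip n S C"
    using ST unfolding flip_cover_def by blast
  interpret A: sym_arcs "n + 1" "arc n S" using sym_arcs_arc[OF n S(1)] .
  interpret B: sym_arcs "n + 1" "arc n T" using sym_arcs_arc[OF n S(2)] .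
  obtain h i j k C' where q: "quadrilateral n S h i j k" "n + 1 < j" "C' = {vertex_at n i, vertex_at n k}"
    "C' = C \<or> C' = half_turn ` C" using green_cases[OF n S(1) C(1,2)] .
  interpret quadrilateral n S h i j k by fact
  have C': "C' \<in> S" "T = flip n S C'" using q(4) C TB_D(4)[OF n S(1)] flip_half_turn by auto
  define m where "m = A.first s"
  have m: "arc n S m (n + 1 + s)" unfolding m_def using A.first_arc s by simp
  have "(m, n + 1 + s) \<noteq> (i, k)" using A.first_le[of h s] arcs(4) order unfolding m_def by auto
  moreover have "\<not> (i \<le> n + 1 \<and> (m, n + 1 + s) = (k - (n + 1), i + (n + 1)))"
  proof (intro notI, elim conjE)
    assume i: "i \<le> n + 1" "(m, n + 1 + s) = (k - (n + 1), i + (n + 1))"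
    then have "arc n S (j - (n + 1)) (n + 1 + s)" using A.turn_mixed[OF arcs(2)] q(2) by (auto simp: add.commute)
    then show False using A.first_le[of "j - (n + 1)" s] i order q(2) unfolding m_def by auto
  qed
  ultimately have "arc n T m (n + 1 + s)" using flip_arcs(2)[OF _ q(2) m] C' q(3) s by auto
  then show ?thesis using B.first_le unfolding bracket_of_def A.bracket_def B.bracket_def m_def
    by (meson max.mono order_refl)
qed

lemma flip_cover_neq:
  assumes n: "1 \<le> n" and ST: "flip_cover n S T"
  shows "S \<noteq> T"
proof -
  obtain C where S: "S \<in> TB n" and C: "C \<in> S" "T = flip n S C"
    using ST unfolding flip_cover_def by blast
  obtain a b c d where "quadrilateral n S a b c d"
    "C = {vertex_at n a, vertex_at n c} \<or> C = {vertex_at n b, vertex_at n d}"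
    using quadrilateral_exists[OF n S C(1)] .
  then show ?thesis using quadrilateral.flip_TB(2,3)[of n S a b c d C] C by blast
qed

lemma flip_cover_exists:
  assumes n: "1 \<le> n" and S: "S \<in> TB n" and w: "bracket_vector (n + 1) w"
    and le: "\<And>j. j \<in> {1..n + 1} \<Longrightarrow> w j \<le> bracket_of n S j"
    and ne: "j0 \<in> {1..n + 1}" "w j0 \<noteq> bracket_of n S j0"
  obtains T where "flip_cover n S T" "\<And>j. j \<in> {1..n + 1} \<Longrightarrow> w j \<le> bracket_of n T j"
proof -
  interpret A: sym_arcs "n + 1" "arc n S" using sym_arcs_arc[OF n S] .
  have "w j0 < A.bracket j0" using le[OF ne(1)] ne(2) unfolding bracket_of_def by simp
  then obtain h i j k where o: "h < i" "i < n + 1 + j" "n + 1 + j < k" "1 \<le> j" "j \<le> n + 1"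
    and ha: "arc n S h i" "arc n S i (n + 1 + j)" "arc n S (n + 1 + j) k" "arc n S h k" "arc n S i k"
    and wj: "w j \<le> max j h" and wh: "h \<le> n + 1 \<Longrightarrow> w h \<le> max h j"
    using A.green_step[OF w _ ne(1)] le unfolding bracket_of_def by metis
  interpret quadrilateral n S h i "n + 1 + j" k by unfold_locales (use n S ha in auto)
  have C: "{v i, v k} \<in> S"
    using ha(5) side_vertex_at[OF n, of i k] o A.range[OF ha(1)] unfolding arc_def by auto
  define T where "T = flip n S {v i, v k}"
  have T: "T \<in> TB n" unfolding T_def by (rule flip_TB(1)[OF C, of "{v h, v (n + 1 + j)}"]) simp
  interpret B: sym_arcs "n + 1" "arc n T" using sym_arcs_arc[OF n T] .
  have "green n S {v i, v k}" using green_higher_diagonal[OF C] o by simp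
  then have "flip_cover n S T" using S T C unfolding flip_cover_def T_def by blast
  moreover have "w c \<le> bracket_of n T c" if c: "c \<in> {1..n + 1}" for c
  proof -
    have "arc n T (B.first c) (n + 1 + c)" using B.first_arc c by simp
    \<comment> \<open>The lowest arc after the flip is an old one, the new diagonal ending at
      \<open>n + 1 + j\<close>, or the image of the new diagonal, ending at
      \<open>n + 1 + h\<close>.\<close>
    then consider "arc n S (B.first c) (n + 1 + c)" | "B.first c = h" "c = j"
      | "h \<le> n + 1" "B.first c = j" "c = h"
      using flip_arcs(1)[OF C] o c unfolding T_def[symmetric] by fastforce
    then show ?thesis
    proof cases
      case 1
      then show ?thesis using A.bracket_le[OF 1] le[OF c] unfolding bracket_of_def B.bracket_def by simp
    next
      case 2
      then show ?thesis using wj unfolding bracket_of_def B.bracket_def by simp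
    next
      case 3
      then show ?thesis using wh unfolding bracket_of_def B.bracket_def by simp
    qed
  qed
  ultimately show thesis using that by blast
qed

section \<open>The order on bracket vectors\<close>

text \<open>This is the least triangulation. The diameter from \<open>n + 1\<close> to
  \<open>2 * (n + 1)\<close> splits the polygon, and each half is a fan from one end of it. For
  \<open>1 \<le> j \<le> n\<close> the lowest neighbour of \<open>n + 1 + j\<close> is its
  predecessor, so the bracket vector is the largest one.\<close>

definition fan :: "nat \<Rightarrow> vertex set set" where
  "fan n = {{vertex_at n p, vertex_at n (n + 1)} | p. 1 \<le> p \<and> p < n} \<union>
    {{vertex_at n p, vertex_at n (2 * (n + 1))} | p. n + 1 \<le> p \<and> p < 2 * n + 1}"

lemma fan_vertex_at:
  assumes "1 \<le> n" "1 \<le> p" "p < q" "q \<le> 2 * (n + 1)"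
  shows "{vertex_at n p, vertex_at n q} \<in> fan n \<longleftrightarrow>
    p < n \<and> q = n + 1 \<or> n + 1 \<le> p \<and> p < 2 * n + 1 \<and> q = 2 * (n + 1)"
  using assms unfolding fan_def by (auto simp: doubleton_eq_iff)

lemma fan_TB:
  assumes n: "1 \<le> n"
  shows "fan n \<in> TB n"
proof (rule TB_I[OF n])
  show sub: "fan n \<subseteq> chords n"
    unfolding fan_def using n by (auto simp: chord_vertex_at)
  show "\<not> crossing n C D" if "C \<in> fan n" "D \<in> fan n" for C D
    using that unfolding fan_def by (auto simp: crossing_vertex_at)
  show "half_turn ` C \<in> fan n" if "C \<in> fan n" for C
  proof -
    have "C \<in> chords n" using sub that by blast
    then obtain p q where pq: "1 \<le> p" "p < q" "q \<le> 2 * (n + 1)" "C = {vertex_at n p, vertex_at n q}"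
      using chordE[OF n] by metis
    then have c: "p < n \<and> q = n + 1 \<or> n + 1 \<le> p \<and> p < 2 * n + 1 \<and> q = 2 * (n + 1)"
      using that fan_vertex_at[OF n] by simp
    then consider "p < n" "q = n + 1" | "p = n + 1" "q = 2 * (n + 1)"
      | "n + 1 < p" "p < 2 * n + 1" "q = 2 * (n + 1)" by linarith
    then show ?thesis
      unfolding pq(4) half_turn_pair[OF pq(1-3)]
      using n pq by cases (auto simp: fan_vertex_at)
  qed
  show "\<exists>D\<in>fan n. crossing n C D" if C: "C \<in> chords n" "C \<notin> fan n" for C
  proof -
    obtain p q where pq: "1 \<le> p" "p < q" "q \<le> 2 * (n + 1)" "C = {vertex_at n p, vertex_at n q}"
      "q \<noteq> Suc p" "\<not> (p = 1 \<and> q = 2 * (n + 1))" using chordE[OF n C(1)] .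
    have nf: "\<not> (p < n \<and> q = n + 1 \<or> n + 1 \<le> p \<and> p < 2 * n + 1 \<and> q = 2 * (n + 1))"
      using C(2) fan_vertex_at[OF n pq(1-3)] pq(4) by simp
    have *: ?thesis if "1 \<le> r" "r < s" "s \<le> 2 * (n + 1)"
      "r < n \<and> s = n + 1 \<or> n + 1 \<le> r \<and> r < 2 * n + 1 \<and> s = 2 * (n + 1)"
      "p < r \<and> r < q \<and> q < s \<or> r < p \<and> p < s \<and> s < q" for r s
    proof (rule bexI[of _ "{vertex_at n r, vertex_at n s}"])
      show "crossing n C {vertex_at n r, vertex_at n s}"
        unfolding pq(4) using that crossing_vertex_at pq by auto
      show "{vertex_at n r, vertex_at n s} \<in> fan n" using fan_vertex_at[OF n] that by auto
    qed
    \<comment> \<open>A chord within one half is crossed by the fan chord at \<open>q - 1\<close>, a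
      chord between the halves by the diameter, and a chord from \<open>2 * (n + 1)\<close> to an
      unbarred vertex \<open>p\<close> below \<open>n + 1\<close> by the fan chord at
      \<open>p - 1\<close>.\<close>
    consider "q \<le> n + 1" | "n + 1 \<le> p" | "p < n + 1" "n + 1 < q" "q < 2 * (n + 1)"
      | "p < n + 1" "q = 2 * (n + 1)" using pq(3) by linarith
    then show ?thesis
    proof cases
      case 1 then show ?thesis using *[of "q - 1" "n + 1"] pq nf by auto
    next
      case 2 then show ?thesis using *[of "q - 1" "2 * (n + 1)"] pq nf by auto
    next
      case 3 then show ?thesis using *[of "n + 1" "2 * (n + 1)"] pq nf n by auto
    next
      case 4 then show ?thesis using *[of "p - 1" "n + 1"] pq nf n by auto
    qed
  qed
qed

section \<open>Realising and comparing bracket vectors\<close>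

lemma bracket_vector_bracket_of: "1 \<le> n \<Longrightarrow> S \<in> TB n \<Longrightarrow> bracket_vector (n + 1) (bracket_of n S)"
  unfolding bracket_of_def by (rule sym_arcs.bracket_vector_bracket) (rule sym_arcs_arc)

lemma bracket_fan:
  assumes n: "1 \<le> n" and w: "bracket_vector (n + 1) w" and j: "j \<in> {1..n + 1}"
  shows "w j \<le> bracket_of n (fan n) j"
proof -
  interpret sym_arcs "n + 1" "arc n (fan n)" using sym_arcs_arc[OF n fan_TB[OF n]] .
  have wj: "w j < n + 1 + j" "w (n + 1) = n + 1" using w j unfolding bracket_vector_def by auto
  show ?thesis
  proof (cases "j = n + 1")
    case True
    then show ?thesis using wj bracket_ge[of j] unfolding bracket_of_def by simp
  next
    case False
    have "arc n (fan n) (first j) (n + 1 + j)" using first_arc j by simp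
    then have "first j = n + j"
      using False j n fan_vertex_at[OF n, of "first j" "n + 1 + j"] side_vertex_at[OF n, of "first j" "n + 1 + j"]
      unfolding arc_def by auto
    then show ?thesis using wj unfolding bracket_of_def bracket_def by simp
  qed
qed

text \<open>Induction on the sum of the entries. While the vector differs from \<open>w\<close>,
  some green flip keeps it above \<open>w\<close>; the sum drops, because a flip raises no entry and
  distinct triangulations have distinct vectors.\<close>

lemma reach_bracket_vector:
  assumes n: "1 \<le> n" and w: "bracket_vector (n + 1) w"
  shows "S \<in> TB n \<Longrightarrow> (\<And>j. j \<in> {1..n + 1} \<Longrightarrow> w j \<le> bracket_of n S j) \<Longrightarrow>
    \<exists>T\<in>TB n. (flip_cover n)\<^sup>*\<^sup>* S T \<and> (\<forall>j\<in>{1..n + 1}. bracket_of n T j = w j)"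
proof (induction "\<Sum>j\<in>{1..n + 1}. bracket_of n S j" arbitrary: S rule: less_induct)
  case less
  show ?case
  proof (cases "\<forall>j\<in>{1..n + 1}. bracket_of n S j = w j")
    case True
    then show ?thesis using less.prems by blast
  next
    case False
    then obtain j0 where "j0 \<in> {1..n + 1}" "w j0 \<noteq> bracket_of n S j0" by metis
    then obtain T where T: "flip_cover n S T" "\<And>j. j \<in> {1..n + 1} \<Longrightarrow> w j \<le> bracket_of n T j"
      using flip_cover_exists[OF n less.prems(1) w less.prems(2)] by metis
    have TT: "T \<in> TB n" using T(1) unfolding flip_cover_def by blast
    have le: "\<forall>j\<in>{1..n + 1}. bracket_of n T j \<le> bracket_of n S j" using flip_cover_bracket_le[OF n T(1)] by blast
    have "\<exists>j\<in>{1..n + 1}. bracket_of n T j \<noteq> bracket_of n S j"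
      using bracket_of_inj[OF n TT less.prems(1)] flip_cover_neq[OF n T(1)] by blast
    then have "\<exists>j\<in>{1..n + 1}. bracket_of n T j < bracket_of n S j" using le by (metis le_neq_implies_less)
    then have "(\<Sum>j\<in>{1..n + 1}. bracket_of n T j) < (\<Sum>j\<in>{1..n + 1}. bracket_of n S j)"
      using le by (intro sum_strict_mono_ex1) auto
    from less.hyps[OF this TT T(2)] obtain U where "U \<in> TB n" "(flip_cover n)\<^sup>*\<^sup>* T U"
      "\<forall>j\<in>{1..n + 1}. bracket_of n U j = w j" by blast
    then show ?thesis using T(1) by (meson converse_rtranclp_into_rtranclp)
  qed
qed

lemma realize_bracket_vector:
  assumes n: "1 \<le> n" and w: "bracket_vector (n + 1) w"
  shows "\<exists>S\<in>TB n. \<forall>j\<in>{1..n + 1}. bracket_of n S j = w j"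
  using reach_bracket_vector[OF n w fan_TB[OF n] bracket_fan[OF n w]] by blast

text \<open>Flips lower vectors. Conversely, flips lead from \<open>S\<close> to a triangulation
  with the vector of \<open>T\<close>, which is \<open>T\<close> by injectivity.\<close>

lemma tamari_le_iff:
  assumes n: "1 \<le> n" and S: "S \<in> TB n" and T: "T \<in> TB n"
  shows "(flip_cover n)\<^sup>*\<^sup>* S T \<longleftrightarrow> (\<forall>j\<in>{1..n + 1}. bracket_of n T j \<le> bracket_of n S j)"
proof
  assume "(flip_cover n)\<^sup>*\<^sup>* S T"
  then show "\<forall>j\<in>{1..n + 1}. bracket_of n T j \<le> bracket_of n S j"
  proof (induction rule: rtranclp_induct)
    case (step T U)
    then show ?case using flip_cover_bracket_le[OF n step.hyps(2)] by (meson order_trans)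
  qed simp
next
  assume "\<forall>j\<in>{1..n + 1}. bracket_of n T j \<le> bracket_of n S j"
  then obtain U where U: "U \<in> TB n" "(flip_cover n)\<^sup>*\<^sup>* S U" "\<forall>j\<in>{1..n + 1}. bracket_of n U j = bracket_of n T j"
    using reach_bracket_vector[OF n bracket_vector_bracket_of[OF n T] S] by blast
  then show "(flip_cover n)\<^sup>*\<^sup>* S T" using bracket_of_inj[OF n U(1) T] by auto
qed

section \<open>Least upper bounds of bracket vectors\<close>

lemma bracket_vectorI:
  assumes "\<And>j. 1 \<le> j \<Longrightarrow> j \<le> N \<Longrightarrow> j \<le> w j \<and> w j < N + j" "w N = N"
    and "\<And>j i. j \<le> N \<Longrightarrow> 1 \<le> i \<Longrightarrow> i < j \<Longrightarrow> w j \<noteq> j \<Longrightarrow> w j < N + i \<Longrightarrow> w j \<le> w i"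
    and "\<And>j. 1 \<le> j \<Longrightarrow> j \<le> N \<Longrightarrow> w j \<le> N \<Longrightarrow> w (w j) = w j"
  shows "bracket_vector N w"
  using assms unfolding bracket_vector_def by auto

lemma bracket_vectorD:
  assumes "bracket_vector N w"
  shows "1 \<le> j \<Longrightarrow> j \<le> N \<Longrightarrow> j \<le> w j" "1 \<le> j \<Longrightarrow> j \<le> N \<Longrightarrow> w j < N + j" "w N = N"
    and "j \<le> N \<Longrightarrow> 1 \<le> i \<Longrightarrow> i < j \<Longrightarrow> w j \<noteq> j \<Longrightarrow> w j < N + i \<Longrightarrow> w j \<le> w i"
    and "1 \<le> j \<Longrightarrow> j \<le> N \<Longrightarrow> w j \<le> N \<Longrightarrow> w (w j) = w j"
  using assms unfolding bracket_vector_def by auto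

lemma bracket_vector_sup:
  assumes N: "1 \<le> N" and f: "bracket_vector N f" and g: "bracket_vector N g"
  shows "\<exists>m. bracket_vector N m \<and> (\<forall>j\<in>{1..N}. f j \<le> m j \<and> g j \<le> m j) \<and>
    (\<forall>v. bracket_vector N v \<longrightarrow> (\<forall>j\<in>{1..N}. f j \<le> v j \<and> g j \<le> v j) \<longrightarrow> (\<forall>j\<in>{1..N}. m j \<le> v j))"
proof -
  define u where "u j = max (f j) (g j)" for j
  \<comment> \<open>The fixed point condition concerns values up to \<open>N\<close> only. Such a
    value is raised to the next fixed point of \<open>u\<close>, which exists because
    \<open>N\<close> is one; larger values stay.\<close>
  define c where "c l = (if N < l then l else LEAST l'. l \<le> l' \<and> u l' = l')" for l
  have uN: "u N = N" using bracket_vectorD(3)[OF f] bracket_vectorD(3)[OF g] unfolding u_def by simp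
  have c1: "l \<le> c l \<and> c l \<le> N \<and> u (c l) = c l" if "l \<le> N" for l
  proof -
    have "l \<le> (LEAST l'. l \<le> l' \<and> u l' = l') \<and> u (LEAST l'. l \<le> l' \<and> u l' = l') = (LEAST l'. l \<le> l' \<and> u l' = l')"
      by (rule LeastI[of _ N]) (use that uN in simp)
    moreover have "(LEAST l'. l \<le> l' \<and> u l' = l') \<le> N" by (rule Least_le) (use that uN in simp)
    ultimately show ?thesis using that unfolding c_def by simp
  qed
  have c2: "c l = l" if "N < l" for l using that unfolding c_def by simp
  have c3: "c l \<le> l'" if "l \<le> l'" "l \<le> N" "u l' = l'" for l l'
    using that unfolding c_def by (auto intro: Least_le)
  have cle: "l \<le> c l" for l using c1[of l] c2[of l] by (cases "l \<le> N") auto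
  have mono: "c l \<le> c l'" if "l \<le> l'" for l l'
  proof (cases "l' \<le> N")
    case True then show ?thesis using c3[of l "c l'"] c1[of l'] that by auto
  next
    case False then show ?thesis using c1[of l] c2[of l] c2[of l'] that by (cases "l \<le> N") auto
  qed
  define m where "m j = c (u j)" for j
  have ub: "j \<le> u j \<and> u j < N + j" if "1 \<le> j" "j \<le> N" for j
    using bracket_vectorD(1,2)[OF f that] bracket_vectorD(1,2)[OF g that] unfolding u_def by simp
  have "bracket_vector N m"
  proof (rule bracket_vectorI)
    show "j \<le> m j \<and> m j < N + j" if "1 \<le> j" "j \<le> N" for j
      using ub[OF that] cle[of "u j"] c1[of "u j"] c2[of "u j"] that unfolding m_def
      by (cases "u j \<le> N") auto
    show "m N = N" using c3[of N N] cle[of N] uN unfolding m_def by simp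
    show "m j \<le> m i" if j: "j \<le> N" "1 \<le> i" "i < j" "m j \<noteq> j" "m j < N + i" for j i
    proof -
      \<comment> \<open>If \<open>u j = j\<close>, then \<open>c\<close> would leave it fixed and
        \<open>m j = j\<close>. So the larger of \<open>f j\<close> and \<open>g j\<close> is not
        the minimal entry, and the closure condition of its own vector applies to it.\<close>
      have uj: "u j \<noteq> j" using c3[of j j] cle[of j] j unfolding m_def by (metis le_antisym order_refl)
      have lt: "u j < N + i" using cle[of "u j"] j unfolding m_def by simp
      have "j \<le> f j" "j \<le> g j" using bracket_vectorD(1) f g j by simp_all
      then consider "u j = f j" "f j \<noteq> j" | "u j = g j" "g j \<noteq> j" using uj unfolding u_def by linarith
      then have "u j \<le> u i"
      proof cases
        case 1
        then have "f j \<le> f i" using bracket_vectorD(4)[OF f] j lt by simp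
        then show ?thesis using 1 unfolding u_def by simp
      next
        case 2
        then have "g j \<le> g i" using bracket_vectorD(4)[OF g] j lt by simp
        then show ?thesis using 2 unfolding u_def by simp
      qed
      then show ?thesis unfolding m_def by (rule mono)
    qed
    show "m (m j) = m j" if "1 \<le> j" "j \<le> N" "m j \<le> N" for j
    proof -
      have "u j \<le> N" using cle[of "u j"] that unfolding m_def by simp
      then have "u (m j) = m j" using c1 unfolding m_def by simp
      then show ?thesis using c3[of "m j" "m j"] cle[of "m j"] that by (simp add: m_def)
    qed
  qed
  moreover have "f j \<le> m j \<and> g j \<le> m j" for j
    using cle[of "u j"] unfolding m_def u_def by simp
  moreover have "m j \<le> v j" if v: "bracket_vector N v" and le: "\<And>j. j \<in> {1..N} \<Longrightarrow> f j \<le> v j \<and> g j \<le> v j"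
    and j: "j \<in> {1..N}" for v j
  proof -
    have uv: "u i \<le> v i" if "i \<in> {1..N}" for i using le[OF that] unfolding u_def by simp
    show ?thesis
    proof (cases "v j \<le> N")
      case True
      have "j \<le> v j" using bracket_vectorD(1)[OF v] j by simp
      then have vj: "v j \<in> {1..N}" using True j by simp
      \<comment> \<open>The value \<open>v j\<close> is fixed by \<open>v\<close>, which dominates
        \<open>u\<close>, and \<open>u\<close> never lies below the identity. So \<open>v j\<close>
        is fixed by \<open>u\<close>, and \<open>c\<close> stops at \<open>v j\<close> or
        earlier.\<close>
      have "u (v j) \<le> v j" using uv[OF vj] bracket_vectorD(5)[OF v, of j] True j by simp
      then have "u (v j) = v j" using ub[of "v j"] vj by simp
      then show ?thesis using c3[of "u j" "v j"] uv[OF j] True unfolding m_def by simp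
    next
      case False
      then show ?thesis using uv[OF j] c1[of "u j"] c2[of "u j"] unfolding m_def
        by (cases "u j \<le> N") auto
    qed
  qed
  ultimately show ?thesis by (intro exI[of _ m]) simp
qed

section \<open>Left modularity\<close>

text \<open>For \<open>i < N\<close> the extreme admissible entries are \<open>N + i - 1\<close> and
  \<open>i\<close>. Hence the vector for \<open>j\<close> with \<open>t = j\<close> is the one for
  \<open>j - 1\<close> with its largest \<open>t\<close>, and the families join into one
  chain.\<close>

definition chain_vector :: "nat \<Rightarrow> nat \<Rightarrow> nat \<Rightarrow> nat \<Rightarrow> nat" where
  "chain_vector N j t i = (if i < j then N + i - 1 else if i = j then t else i)"

text \<open>A maximal entry \<open>N + k - 1\<close> is never below \<open>N + i\<close> for
  \<open>i < k\<close>, so closure is vacuous for it; as the entry of a smaller index it dominates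
  every value closure compares with it. Raising \<open>z j\<close> to \<open>t\<close> preserves the
  bounds on later entries.\<close>

lemma bracket_vector_raise:
  assumes z: "bracket_vector N z" and j: "1 \<le> j" "j < N" and t: "z j \<le> t" "t < N + j"
    and tN: "t \<le> N \<Longrightarrow> z t = t"
  shows "bracket_vector N (\<lambda>i. if i < j then N + i - 1 else if i = j then t else z i)" (is "bracket_vector N ?w")
proof (rule bracket_vectorI)
  note zD = bracket_vectorD[OF z]
  have jt: "j \<le> t" using zD(1)[of j] j t by simp
  show "i \<le> ?w i \<and> ?w i < N + i" if "1 \<le> i" "i \<le> N" for i
    using zD(1,2)[OF that] jt t j that by auto
  show "?w N = N" using zD(3) j by simp
  show "?w k \<le> ?w i" if k: "k \<le> N" "1 \<le> i" "i < k" "?w k \<noteq> k" "?w k < N + i" for k i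
  proof -
    consider "k < j" | "k = j" | "j < k" by linarith
    then show ?thesis
    proof cases
      case 1 then show ?thesis using k by auto
    next
      case 2 then show ?thesis using k by auto
    next
      case 3
      then have "z k \<noteq> k" "z k < N + i" using k by auto
      then have "z k \<le> z i" using zD(4)[of k i] k by auto
      moreover have "z k < N + i" by fact
      ultimately show ?thesis using 3 t by auto
    qed
  qed
  show "?w (?w k) = ?w k" if k: "1 \<le> k" "k \<le> N" "?w k \<le> N" for k
  proof -
    consider "k < j" | "k = j" | "j < k" by linarith
    then show ?thesis
    proof cases
      case 1
      \<comment> \<open>Among the maximal entries only the first is at most \<open>N\<close>; it
        equals the fixed point \<open>N\<close>.\<close>
      then have "k = 1" "?w k = N" using k by (auto split: if_splits)
      then show ?thesis using zD(3) j by simp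
    next
      case 2
      then show ?thesis using k tN jt by auto
    next
      case 3
      then show ?thesis using k zD(1)[of k] zD(5)[of k] by auto
    qed
  qed
qed

text \<open>Minimal entries are exempt from closure and are fixed points, so only the entry
  \<open>t\<close> needs a closure hypothesis of its own.\<close>

lemma bracket_vector_lower:
  assumes y: "bracket_vector N y" and j: "1 \<le> j" "j < N" and t: "j \<le> t" "t \<le> y j"
    and a: "\<And>i. t \<noteq> j \<Longrightarrow> 1 \<le> i \<Longrightarrow> i < j \<Longrightarrow> t < N + i \<Longrightarrow> t \<le> y i"
  shows "bracket_vector N (\<lambda>i. if i < j then y i else if i = j then t else i)" (is "bracket_vector N ?w")
proof (rule bracket_vectorI)
  note yD = bracket_vectorD[OF y]
  show "i \<le> ?w i \<and> ?w i < N + i" if "1 \<le> i" "i \<le> N" for i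
    using yD(1,2)[OF that] t j that by auto
  show "?w N = N" using j by simp
  show "?w k \<le> ?w i" if k: "k \<le> N" "1 \<le> i" "i < k" "?w k \<noteq> k" "?w k < N + i" for k i
  proof -
    consider "k < j" | "k = j" | "j < k" by linarith
    then show ?thesis
    proof cases
      case 1 then show ?thesis using k yD(4)[of k i] by auto
    next
      case 2 then show ?thesis using k a[of i] by auto
    next
      case 3 then show ?thesis using k by auto
    qed
  qed
  show "?w (?w k) = ?w k" if k: "1 \<le> k" "k \<le> N" "?w k \<le> N" for k
  proof -
    consider "k < j" | "k = j" | "j < k" by linarith
    then show ?thesis
    proof cases
      case 1
      \<comment> \<open>If the fixed point \<open>y k\<close> is \<open>j\<close> itself, then
        \<open>y j = j\<close> forces \<open>t = j\<close>; after \<open>j\<close> every index is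
        fixed anyway.\<close>
      then have "y (y k) = y k" using yD(5)[of k] k by auto
      then show ?thesis using 1 t by auto
    qed (use t in auto)
  qed
qed

lemma bracket_vector_id: "1 \<le> N \<Longrightarrow> bracket_vector N (\<lambda>i. i)"
  by (rule bracket_vectorI) auto

lemma bracket_vector_chain:
  assumes "1 \<le> j" "j < N" "j \<le> t" "t < N + j"
  shows "bracket_vector N (chain_vector N j t)"
  using bracket_vector_raise[OF bracket_vector_id, of N j t] assms unfolding chain_vector_def by simp

text \<open>Larger bracket vectors belong to smaller triangulations, so here \<open>y\<close> lies below \<open>z\<close>.\<close>

lemma chain_vector_separates:
  assumes y: "bracket_vector N y" and z: "bracket_vector N z" and le: "\<And>i. i \<in> {1..N} \<Longrightarrow> z i \<le> y i"
    and ne: "i0 \<in> {1..N}" "z i0 \<noteq> y i0" and j: "1 \<le> j" "j < N" and t: "j \<le> t" "t < N + j"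
  obtains v where "bracket_vector N v" "\<And>i. i \<in> {1..N} \<Longrightarrow> v i \<le> chain_vector N j t i"
      "\<And>i. i \<in> {1..N} \<Longrightarrow> v i \<le> y i" "\<exists>i\<in>{1..N}. z i < v i"
    | v where "bracket_vector N v" "\<And>i. i \<in> {1..N} \<Longrightarrow> chain_vector N j t i \<le> v i"
      "\<And>i. i \<in> {1..N} \<Longrightarrow> z i \<le> v i" "\<exists>i\<in>{1..N}. v i < y i"
proof -
  note below = that(1) and above = that(2)
  note yD = bracket_vectorD[OF y] and zD = bracket_vectorD[OF z]
  \<comment> \<open>For suitable \<open>s\<close>, \<open>U s\<close> lies below \<open>y\<close>
    and the chain vector and shows differences before \<open>j\<close>, while \<open>D s\<close>
    lies above \<open>z\<close> and the chain vector and shows differences after \<open>j\<close>. A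
    difference at \<open>j\<close> is detected by the choice of \<open>s\<close>.\<close>
  define U where "U s i = (if i < j then y i else if i = j then s else i)" for s i
  define D where "D s i = (if i < j then N + i - 1 else if i = j then s else z i)" for s i
  have jj: "j \<in> {1..N}" "z j \<le> y j" using j le by auto
  have U: thesis if s: "j \<le> s" "s \<le> y j" "s \<le> t" "\<exists>i\<in>{1..N}. z i < U s i"
      "\<And>i. s \<noteq> j \<Longrightarrow> 1 \<le> i \<Longrightarrow> i < j \<Longrightarrow> s < N + i \<Longrightarrow> s \<le> y i" for s
  proof (rule below)
    show "bracket_vector N (U s)" using bracket_vector_lower[OF y j s(1,2,5)] unfolding U_def by simp
    show "U s i \<le> chain_vector N j t i" if "i \<in> {1..N}" for i
      using yD(2)[of i] that s unfolding U_def chain_vector_def by auto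
    show "U s i \<le> y i" if "i \<in> {1..N}" for i using yD(1)[of i] that s unfolding U_def by auto
  qed (rule s(4))
  have D: thesis if s: "z j \<le> s" "s < N + j" "t \<le> s" "s \<le> N \<Longrightarrow> z s = s" "\<exists>i\<in>{1..N}. D s i < y i" for s
  proof (rule above)
    show "bracket_vector N (D s)" using bracket_vector_raise[OF z j s(1,2,4)] unfolding D_def by simp
    show "chain_vector N j t i \<le> D s i" if "i \<in> {1..N}" for i
      using zD(1)[of i] that s unfolding D_def chain_vector_def by auto
    show "z i \<le> D s i" if "i \<in> {1..N}" for i using zD(2)[of i] that s unfolding D_def by auto
  qed (rule s(5))
  have i0: "z i0 < y i0" using le[OF ne(1)] ne(2) by simp
  have yj: "y j < N + j" "j \<le> z j" using yD(2) zD(1) j by auto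
  consider "i0 < j" | "i0 = j" | "j < i0" by linarith
  then show thesis
  proof cases
    case 1
    then have "\<exists>i\<in>{1..N}. z i < U j i" using ne(1) i0 unfolding U_def by (intro bexI[of _ i0]) auto
    then show thesis using U[of j] yj jj t by auto
  next
    case 3
    \<comment> \<open>The largest entry at \<open>j\<close> dominates \<open>z j\<close> and
      \<open>t\<close>; it is at most \<open>N\<close> only for \<open>j = 1\<close>, where it is
      the fixed point \<open>N\<close>.\<close>
    let ?s = "N + j - 1"
    have "\<exists>i\<in>{1..N}. D ?s i < y i"
      using 3 ne(1) i0 unfolding D_def by (intro bexI[of _ i0]) auto
    moreover have "z ?s = ?s" if "?s \<le> N"
    proof -
      have "?s = N" using that j by simp
      then show ?thesis using zD(3) by simp
    qed
    moreover have "z j \<le> ?s" "?s < N + j" "t \<le> ?s" using yj jj t j by linarith+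
    ultimately show thesis using D by blast
  next
    case 2
    then have zy: "z j < y j" using i0 by simp
    have Uj: "\<exists>i\<in>{1..N}. z i < U s i" if "z j < s" for s
      using that jj(1) unfolding U_def by (intro bexI[of _ j]) auto
    have Dj: "\<exists>i\<in>{1..N}. D s i < y i" if "s < y j" for s
      using that jj(1) unfolding D_def by (intro bexI[of _ j]) auto
    \<comment> \<open>The entry at \<open>j\<close> is taken from \<open>y\<close> or
      \<open>z\<close> when \<open>t\<close> is not strictly between them. Otherwise
      \<open>t\<close> can be used in \<open>D\<close> if \<open>t > N\<close>, and in
      \<open>U\<close> if \<open>y j \<le> N\<close>, since closure then puts all earlier entries of
      \<open>y\<close> above \<open>y j\<close>. In the remaining case the fixed point
      \<open>N\<close> serves in \<open>D\<close>.\<close>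
    consider "y j \<le> t" | "t \<le> z j" | "z j < t" "t < y j" "N < t" | "z j < t" "t \<le> N" "N < y j"
      | "z j < t" "t < y j" "y j \<le> N" by linarith
    then show thesis
    proof cases
      case 1 then show thesis using U[of "y j"] Uj zy yj jj yD(4)[of j] j by auto
    next
      case 2 then show thesis using D[of "z j"] Dj zy yj jj zD(5)[of j] j by auto
    next
      case 3 then show thesis using D[of t] Dj zy yj jj j by auto
    next
      case 4 then show thesis using D[of N] Dj zy yj jj j zD(3) by auto
    next
      case 5
      have "t \<le> y i" if "1 \<le> i" "i < j" for i
      proof -
        have "y j \<le> y i" using yD(4)[of j i] j that 5 yj by auto
        then show ?thesis using 5 by simp
      qed
      then show thesis using U[of t] Uj zy yj jj j 5 t by auto
    qed
  qed
qed

text \<open>The separation is applied to the two sides \<open>a\<close> and \<open>b\<close> of the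
  modular identity, which always satisfy \<open>a \<sqsubseteq> b\<close>. An upper bound of
  \<open>x\<close> and \<open>a\<close> is above the join of \<open>y\<close> and \<open>x\<close>,
  hence above \<open>b\<close>; a lower bound of \<open>x\<close> and \<open>b\<close> is below the
  meet of \<open>x\<close> and \<open>z\<close>, hence below \<open>a\<close>. So \<open>a\<close>
  and \<open>b\<close> cannot differ.\<close>

lemma (in lattice) left_modularI:
  assumes x: "x \<in> carrier L"
    and sep: "\<And>y z. y \<in> carrier L \<Longrightarrow> z \<in> carrier L \<Longrightarrow> y \<sqsubset> z \<Longrightarrow>
      (\<exists>u\<in>carrier L. x \<sqsubseteq> u \<and> y \<sqsubseteq> u \<and> \<not> z \<sqsubseteq> u) \<or>
      (\<exists>u\<in>carrier L. u \<sqsubseteq> x \<and> u \<sqsubseteq> z \<and> \<not> u \<sqsubseteq> y)"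
  shows "left_modular L x"
  unfolding left_modular_def
proof (intro conjI ballI impI x)
  fix y z assume y: "y \<in> carrier L" and z: "z \<in> carrier L" and yz: "y \<sqsubset> z"
  define a b where "a = y \<squnion> (x \<sqinter> z)" and "b = (y \<squnion> x) \<sqinter> z"
  have c: "a \<in> carrier L" "b \<in> carrier L" "x \<sqinter> z \<in> carrier L" "y \<squnion> x \<in> carrier L"
    unfolding a_def b_def using x y z by auto
  have yz': "y \<sqsubseteq> z" using yz by (rule lless_imp_le)
  have m: "x \<sqinter> z \<sqsubseteq> x" "x \<sqinter> z \<sqsubseteq> z" using meet_left meet_right x z by auto
  have j: "y \<sqsubseteq> y \<squnion> x" "x \<sqsubseteq> y \<squnion> x" using join_left join_right x y by auto
  have mj: "x \<sqinter> z \<sqsubseteq> y \<squnion> x" using le_trans[OF m(1) j(2)] c x by blast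
  have "y \<sqsubseteq> b" unfolding b_def using meet_le[OF j(1) yz'] y z c by blast
  moreover have "x \<sqinter> z \<sqsubseteq> b" unfolding b_def using meet_le[OF mj m(2)] z c by blast
  ultimately have ab: "a \<sqsubseteq> b" unfolding a_def using join_le y c by blast
  have ya: "y \<sqsubseteq> a" "x \<sqinter> z \<sqsubseteq> a" unfolding a_def using join_left join_right y c by auto
  have bz: "b \<sqsubseteq> y \<squnion> x" "b \<sqsubseteq> z" unfolding b_def using meet_left meet_right z c by auto
  have "a = b"
  proof (rule ccontr)
    assume "a \<noteq> b"
    then have "a \<sqsubset> b" using ab by (simp add: lless_eq)
    from sep[OF c(1,2) this] show False
    proof (elim disjE bexE conjE)
      fix u assume u: "u \<in> carrier L" "x \<sqsubseteq> u" "a \<sqsubseteq> u" "\<not> b \<sqsubseteq> u"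
      have "y \<sqsubseteq> u" using le_trans[OF ya(1) u(3)] y c u by blast
      then have "y \<squnion> x \<sqsubseteq> u" using join_le u x y by blast
      then show False using le_trans[OF bz(1)] u c by blast
    next
      fix u assume u: "u \<in> carrier L" "u \<sqsubseteq> x" "u \<sqsubseteq> b" "\<not> u \<sqsubseteq> a"
      have "u \<sqsubseteq> z" using le_trans[OF u(3) bz(2)] z c u by blast
      then have "u \<sqsubseteq> x \<sqinter> z" using meet_le u x z by blast
      then show False using le_trans[OF _ ya(2)] u c by blast
    qed
  qed
  then show "(y \<squnion> x) \<sqinter> z = y \<squnion> (x \<sqinter> z)" unfolding a_def b_def by simp
qed

section \<open>The Tamari order as a lattice\<close>

lemma carrier_tamari_B [simp]: "carrier (tamari_B n) = TB n"
  and eq_tamari_B [simp]: "eq (tamari_B n) = (=)"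
  and le_tamari_B: "le (tamari_B n) = (flip_cover n)\<^sup>*\<^sup>*"
  unfolding tamari_B_def by simp_all

lemma tamari_B_le_iff:
  assumes "1 \<le> n" "S \<in> TB n" "T \<in> TB n"
  shows "S \<sqsubseteq>\<^bsub>tamari_B n\<^esub> T \<longleftrightarrow> (\<forall>j\<in>{1..n + 1}. bracket_of n T j \<le> bracket_of n S j)"
  using tamari_le_iff[OF assms] unfolding le_tamari_B .

lemma partial_order_tamari_B:
  assumes n: "1 \<le> n" shows "partial_order (tamari_B n)"
proof
  have "x = y" if "x \<sqsubseteq>\<^bsub>tamari_B n\<^esub> y" "y \<sqsubseteq>\<^bsub>tamari_B n\<^esub> x"
    "x \<in> carrier (tamari_B n)" "y \<in> carrier (tamari_B n)" for x y
  proof -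
    have c: "x \<in> TB n" "y \<in> TB n" using that by simp_all
    show ?thesis
      using that(1,2) unfolding tamari_B_le_iff[OF n c] tamari_B_le_iff[OF n c(2,1)]
      by (intro bracket_of_inj[OF n c] order_antisym) blast+
  qed
  then show "x .=\<^bsub>tamari_B n\<^esub> y" if "x \<sqsubseteq>\<^bsub>tamari_B n\<^esub> y" "y \<sqsubseteq>\<^bsub>tamari_B n\<^esub> x"
    "x \<in> carrier (tamari_B n)" "y \<in> carrier (tamari_B n)" for x y
    using that by simp
qed (auto simp: le_tamari_B)

lemma tamari_B_meet:
  assumes n: "1 \<le> n" and S: "S \<in> TB n" and T: "T \<in> TB n"
  shows "\<exists>M. greatest (tamari_B n) M (Lower (tamari_B n) {S, T})"
proof -
  note bv = bracket_vector_bracket_of[OF n]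
  obtain m where m: "bracket_vector (n + 1) m"
    "\<forall>j\<in>{1..n + 1}. bracket_of n S j \<le> m j \<and> bracket_of n T j \<le> m j"
    "\<forall>v. bracket_vector (n + 1) v \<longrightarrow> (\<forall>j\<in>{1..n + 1}. bracket_of n S j \<le> v j \<and> bracket_of n T j \<le> v j) \<longrightarrow>
      (\<forall>j\<in>{1..n + 1}. m j \<le> v j)"
    using bracket_vector_sup[OF le_add2 bv[OF S] bv[OF T]] by blast
  obtain M where M: "M \<in> TB n" "\<forall>j\<in>{1..n + 1}. bracket_of n M j = m j"
    using realize_bracket_vector[OF n m(1)] by blast
  have lb: "M \<sqsubseteq>\<^bsub>tamari_B n\<^esub> S" "M \<sqsubseteq>\<^bsub>tamari_B n\<^esub> T"
    unfolding tamari_B_le_iff[OF n M(1) S] tamari_B_le_iff[OF n M(1) T] using M(2) m(2) by simp_all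
  have glb: "U \<sqsubseteq>\<^bsub>tamari_B n\<^esub> M"
    if U: "U \<in> TB n" "U \<sqsubseteq>\<^bsub>tamari_B n\<^esub> S" "U \<sqsubseteq>\<^bsub>tamari_B n\<^esub> T" for U
  proof -
    have "\<forall>j\<in>{1..n + 1}. bracket_of n S j \<le> bracket_of n U j \<and> bracket_of n T j \<le> bracket_of n U j"
      using U(2,3) unfolding tamari_B_le_iff[OF n U(1) S] tamari_B_le_iff[OF n U(1) T] by blast
    then have "\<forall>j\<in>{1..n + 1}. m j \<le> bracket_of n U j" using m(3) bv[OF U(1)] by blast
    then show ?thesis unfolding tamari_B_le_iff[OF n U(1) M(1)] using M(2) by simp
  qed
  have "greatest (tamari_B n) M (Lower (tamari_B n) {S, T})"
    using M(1) S T lb glb unfolding greatest_def Lower_def by auto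
  then show ?thesis ..
qed

lemma tamari_B_top:
  assumes n: "1 \<le> n"
    and S: "S \<in> TB n" "\<And>j. j \<in> {1..n + 1} \<Longrightarrow> bracket_of n S j = j"
  shows "T \<in> TB n \<Longrightarrow> T \<sqsubseteq>\<^bsub>tamari_B n\<^esub> S"
  using tamari_B_le_iff[OF n _ S(1)] S(2) bracket_vectorD(1)[OF bracket_vector_bracket_of[OF n]] by simp

text \<open>Joins come from meets by finiteness. Among the upper bounds, which include the top, one
  with the largest sum of entries is chosen; its meet with any other upper bound is an upper bound
  with entries at least as large, hence equal to it.\<close>

lemma lattice_tamari_B:
  assumes n: "1 \<le> n" shows "lattice (tamari_B n)"
proof -
  let ?L = "tamari_B n"
  interpret partial_order ?L by (rule partial_order_tamari_B[OF n])
  have sup: "\<exists>s. least ?L s (Upper ?L {S, T})" if ST: "S \<in> TB n" "T \<in> TB n" for S T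
  proof -
    define P where "P U \<longleftrightarrow> U \<in> TB n \<and> S \<sqsubseteq>\<^bsub>?L\<^esub> U \<and> T \<sqsubseteq>\<^bsub>?L\<^esub> U" for U
    define \<mu> where "\<mu> U = (\<Sum>j\<in>{1..n + 1}. bracket_of n U j)" for U
    obtain U0 where U0: "U0 \<in> TB n" "\<And>j. j \<in> {1..n + 1} \<Longrightarrow> bracket_of n U0 j = j"
      using realize_bracket_vector[OF n bracket_vector_id[OF le_add2]] by blast
    have "P U0" unfolding P_def using U0 tamari_B_top[OF n U0] ST by simp
    moreover have "\<forall>U. P U \<longrightarrow> \<mu> U \<le> (\<Sum>j\<in>{1..n + 1}. bracket_of n S j)"
    proof (intro allI impI)
      fix U assume "P U"
      then have "U \<in> TB n" "S \<sqsubseteq>\<^bsub>?L\<^esub> U" unfolding P_def by auto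
      then show "\<mu> U \<le> (\<Sum>j\<in>{1..n + 1}. bracket_of n S j)"
        unfolding \<mu>_def using tamari_B_le_iff[OF n ST(1)] by (intro sum_mono) blast
    qed
    ultimately obtain U where U: "P U" "\<And>U'. P U' \<Longrightarrow> \<mu> U' \<le> \<mu> U"
      using ex_has_greatest_nat[of P U0 \<mu>] by (metis le_imp_less_Suc)
    have "U \<sqsubseteq>\<^bsub>?L\<^esub> U'" if U': "P U'" for U'
    proof -
      have c: "U \<in> TB n" "U' \<in> TB n" using U U' unfolding P_def by auto
      obtain M where "greatest ?L M (Lower ?L {U, U'})" using tamari_B_meet[OF n c] by blast
      then have M: "M \<in> TB n" "M \<sqsubseteq>\<^bsub>?L\<^esub> U" "M \<sqsubseteq>\<^bsub>?L\<^esub> U'"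
        "\<And>V. V \<in> TB n \<Longrightarrow> V \<sqsubseteq>\<^bsub>?L\<^esub> U \<Longrightarrow> V \<sqsubseteq>\<^bsub>?L\<^esub> U' \<Longrightarrow> V \<sqsubseteq>\<^bsub>?L\<^esub> M"
        using c unfolding greatest_def Lower_def by auto
      have "P M" using M U(1) U' ST unfolding P_def by auto
      have le: "\<forall>j\<in>{1..n + 1}. bracket_of n U j \<le> bracket_of n M j"
        using M(2) tamari_B_le_iff[OF n M(1) c(1)] by blast
      have "bracket_of n M j = bracket_of n U j" if "j \<in> {1..n + 1}" for j
      proof (rule ccontr)
        assume "bracket_of n M j \<noteq> bracket_of n U j"
        then have "\<exists>j\<in>{1..n + 1}. bracket_of n U j < bracket_of n M j" using le that by (metis le_neq_implies_less)
        then have "\<mu> U < \<mu> M" unfolding \<mu>_def using le by (intro sum_strict_mono_ex1) auto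
        then show False using U(2)[OF \<open>P M\<close>] by simp
      qed
      then have "M = U" using bracket_of_inj[OF n M(1) c(1)] by blast
      then show ?thesis using M(3) by simp
    qed
    then have "least ?L U (Upper ?L {S, T})" using U(1) ST unfolding least_def Upper_def P_def by auto
    then show ?thesis ..
  qed
  show ?thesis by unfold_locales (use tamari_B_meet[OF n] sup in simp_all)
qed

section \<open>The chain of left modular elements\<close>

lemma left_modular_chain_vector:
  assumes n: "1 \<le> n" and S: "S \<in> TB n" and j: "1 \<le> j" "j \<le> n" and t: "j \<le> t" "t \<le> n + j"
    and br: "\<And>i. i \<in> {1..n + 1} \<Longrightarrow> bracket_of n S i = chain_vector (n + 1) j t i"
  shows "left_modular (tamari_B n) S"
proof -
  let ?L = "tamari_B n"
  interpret lattice ?L by (rule lattice_tamari_B[OF n])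
  show ?thesis
  proof (rule left_modularI)
    show "S \<in> carrier ?L" using S by simp
    fix Y Z assume YZ: "Y \<in> carrier ?L" "Z \<in> carrier ?L" "Y \<sqsubset>\<^bsub>?L\<^esub> Z"
    then have c: "Y \<in> TB n" "Z \<in> TB n" and le: "Y \<sqsubseteq>\<^bsub>?L\<^esub> Z" "Y \<noteq> Z" by (auto simp: lless_eq)
    obtain i0 where i0: "i0 \<in> {1..n + 1}" "bracket_of n Z i0 \<noteq> bracket_of n Y i0"
      using bracket_of_inj[OF n c] le(2) by metis
    have le': "\<And>i. i \<in> {1..n + 1} \<Longrightarrow> bracket_of n Z i \<le> bracket_of n Y i"
      using le(1) tamari_B_le_iff[OF n c] by blast
    have bounds: "j < n + 1" "t < n + 1 + j" using j t by auto
    note bv = bracket_vector_bracket_of[OF n]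
    show "(\<exists>U\<in>carrier ?L. S \<sqsubseteq>\<^bsub>?L\<^esub> U \<and> Y \<sqsubseteq>\<^bsub>?L\<^esub> U \<and> \<not> Z \<sqsubseteq>\<^bsub>?L\<^esub> U) \<or>
      (\<exists>U\<in>carrier ?L. U \<sqsubseteq>\<^bsub>?L\<^esub> S \<and> U \<sqsubseteq>\<^bsub>?L\<^esub> Z \<and> \<not> U \<sqsubseteq>\<^bsub>?L\<^esub> Y)"
    \<comment> \<open>The order is reversed: a vector below those of \<open>S\<close> and
      \<open>Y\<close> gives an upper bound of them, and a vector above those of \<open>S\<close>
      and \<open>Z\<close> gives a lower bound.\<close>
    proof (rule chain_vector_separates[OF bv[OF c(1)] bv[OF c(2)] le' i0 j(1) bounds(1) t(1) bounds(2)])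
      fix v assume v: "bracket_vector (n + 1) v" "\<And>i. i \<in> {1..n + 1} \<Longrightarrow> v i \<le> chain_vector (n + 1) j t i"
        "\<And>i. i \<in> {1..n + 1} \<Longrightarrow> v i \<le> bracket_of n Y i" "\<exists>i\<in>{1..n + 1}. bracket_of n Z i < v i"
      obtain U where U: "U \<in> TB n" "\<And>i. i \<in> {1..n + 1} \<Longrightarrow> bracket_of n U i = v i"
        using realize_bracket_vector[OF n v(1)] by blast
      have "S \<sqsubseteq>\<^bsub>?L\<^esub> U \<and> Y \<sqsubseteq>\<^bsub>?L\<^esub> U \<and> \<not> Z \<sqsubseteq>\<^bsub>?L\<^esub> U"
        using v(2-4) U br unfolding tamari_B_le_iff[OF n S U(1)] tamari_B_le_iff[OF n c(1) U(1)]
          tamari_B_le_iff[OF n c(2) U(1)] by (force simp: not_le)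
      then show ?thesis using U(1) by auto
    next
      fix v assume v: "bracket_vector (n + 1) v" "\<And>i. i \<in> {1..n + 1} \<Longrightarrow> chain_vector (n + 1) j t i \<le> v i"
        "\<And>i. i \<in> {1..n + 1} \<Longrightarrow> bracket_of n Z i \<le> v i" "\<exists>i\<in>{1..n + 1}. v i < bracket_of n Y i"
      obtain U where U: "U \<in> TB n" "\<And>i. i \<in> {1..n + 1} \<Longrightarrow> bracket_of n U i = v i"
        using realize_bracket_vector[OF n v(1)] by blast
      have "U \<sqsubseteq>\<^bsub>?L\<^esub> S \<and> U \<sqsubseteq>\<^bsub>?L\<^esub> Z \<and> \<not> U \<sqsubseteq>\<^bsub>?L\<^esub> Y"
        using v(2-4) U br unfolding tamari_B_le_iff[OF n U(1) S] tamari_B_le_iff[OF n U(1) c(1)]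
          tamari_B_le_iff[OF n U(1) c(2)] by (force simp: not_le)
      then show ?thesis using U(1) by auto
    qed
  qed
qed

text \<open>Nothing fits between two vectors that differ by one in a single entry, and vectors
  determine triangulations.\<close>

lemma tamari_B_covered_by:
  assumes n: "1 \<le> n" and S: "S \<in> TB n" and T: "T \<in> TB n" and j: "j \<in> {1..n + 1}"
    and br: "\<And>i. i \<in> {1..n + 1} \<Longrightarrow> bracket_of n S i = (if i = j then Suc (bracket_of n T i) else bracket_of n T i)"
  shows "covered_by (tamari_B n) S T"
proof -
  let ?L = "tamari_B n"
  interpret lattice ?L by (rule lattice_tamari_B[OF n])
  have "S \<noteq> T" using br[OF j] by auto
  moreover have "S \<sqsubseteq>\<^bsub>?L\<^esub> T" unfolding tamari_B_le_iff[OF n S T] using br by simp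
  moreover have "U = S \<or> U = T" if U: "U \<in> TB n" "S \<sqsubseteq>\<^bsub>?L\<^esub> U" "U \<sqsubseteq>\<^bsub>?L\<^esub> T" for U
  proof -
    have le: "bracket_of n T i \<le> bracket_of n U i \<and> bracket_of n U i \<le> bracket_of n S i" if "i \<in> {1..n + 1}" for i
      using U that tamari_B_le_iff[OF n U(1) T] tamari_B_le_iff[OF n S U(1)] by blast
    have "bracket_of n U i = bracket_of n T i" if "i \<in> {1..n + 1}" "i \<noteq> j" for i
      using le[OF that(1)] br[OF that(1)] that(2) by simp
    moreover have "bracket_of n U j = bracket_of n T j \<or> bracket_of n U j = bracket_of n S j"
      using le[OF j] br[OF j] by auto
    ultimately show ?thesis using bracket_of_inj[OF n U(1) S] bracket_of_inj[OF n U(1) T] br by metis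
  qed
  ultimately show ?thesis unfolding covered_by_def using S T by (auto simp: lless_eq)
qed

theorem theorem2:
  fixes n :: nat
  assumes "n \<ge> 1"
  shows "lattice (tamari_B n) \<and> (\<exists>xs. unrefinable_left_modular_chain (tamari_B n) xs)"
proof
  note n = assms
  let ?L = "tamari_B n" and ?N = "n + 1"
  show "lattice ?L" by (rule lattice_tamari_B[OF n])
  \<comment> \<open>The chain is built from the bottom upwards: entry \<open>n\<close> is lowered
    first, then entry \<open>n - 1\<close>, and so on.\<close>
  define reaches where "reaches w \<longleftrightarrow> (\<exists>xs. xs \<noteq> [] \<and> least ?L (hd xs) (TB n) \<and> last xs \<in> TB n \<and>
      (\<forall>i\<in>{1..n + 1}. bracket_of n (last xs) i = w i) \<and>
      successively (covered_by ?L) xs \<and> (\<forall>S\<in>set xs. left_modular ?L S))" for w :: "nat \<Rightarrow> nat"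
  have cong: "reaches w" if "reaches w'" "\<And>i. i \<in> {1..n + 1} \<Longrightarrow> w' i = w i" for w w'
    using that unfolding reaches_def by metis
  have real: "\<exists>S\<in>TB n. (\<forall>i\<in>{1..n + 1}. bracket_of n S i = chain_vector ?N j t i) \<and> left_modular ?L S"
    if j: "1 \<le> j" "j \<le> n" and t: "j \<le> t" "t \<le> n + j" for j t
  proof -
    have "bracket_vector ?N (chain_vector ?N j t)" by (rule bracket_vector_chain) (use j t in auto)
    then obtain S where "S \<in> TB n" "\<forall>i\<in>{1..n + 1}. bracket_of n S i = chain_vector ?N j t i"
      using realize_bracket_vector[OF n] by blast
    then show ?thesis using left_modular_chain_vector[OF n _ j t] by blast
  qed
  \<comment> \<open>The starting vector has every entry maximal, so it belongs to the least
    triangulation.\<close>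
  have start: "reaches (chain_vector ?N n (n + n))"
  proof -
    obtain S where S: "S \<in> TB n" "\<forall>i\<in>{1..n + 1}. bracket_of n S i = chain_vector ?N n (n + n) i" "left_modular ?L S"
      using real[of n "n + n"] n by auto
    have "S \<sqsubseteq>\<^bsub>?L\<^esub> T" if T: "T \<in> TB n" for T
      unfolding tamari_B_le_iff[OF n S(1) T]
    proof
      fix i assume i: "i \<in> {1..n + 1}"
      show "bracket_of n T i \<le> bracket_of n S i"
        using bracket_vectorD(2,3)[OF bracket_vector_bracket_of[OF n T]] i S(2)
        by (cases "i = n + 1") (fastforce simp: chain_vector_def)+
    qed
    then have "least ?L S (TB n)" unfolding least_def using S(1) by auto
    then show ?thesis unfolding reaches_def using S by (intro exI[of _ "[S]"]) simp
  qed
  have step: "reaches (chain_vector ?N j t)" if r: "reaches (chain_vector ?N j (Suc t))"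
    and j: "1 \<le> j" "j \<le> n" and t: "j \<le> t" "Suc t \<le> n + j" for j t
  proof -
    obtain xs where xs: "xs \<noteq> []" "least ?L (hd xs) (TB n)" "last xs \<in> TB n"
      "\<forall>i\<in>{1..n + 1}. bracket_of n (last xs) i = chain_vector ?N j (Suc t) i"
      "successively (covered_by ?L) xs" "\<forall>S\<in>set xs. left_modular ?L S"
      using r unfolding reaches_def by blast
    obtain S where S: "S \<in> TB n" "\<forall>i\<in>{1..n + 1}. bracket_of n S i = chain_vector ?N j t i" "left_modular ?L S"
      using real[of j t] j t by auto
    have "covered_by ?L (last xs) S"
      by (rule tamari_B_covered_by[OF n xs(3) S(1), of j]) (use j xs(4) S(2) in \<open>auto simp: chain_vector_def\<close>)
    then show ?thesis unfolding reaches_def using xs S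
      by (intro exI[of _ "xs @ [S]"]) (auto simp: successively_append_iff)
  qed
  have inner: "reaches (chain_vector ?N j (n + j - k))"
    if "reaches (chain_vector ?N j (n + j))" "1 \<le> j" "j \<le> n" "k \<le> n" for j k
    using that(4)
  proof (induction k)
    case 0 then show ?case using that by simp
  next
    case (Suc k)
    have "Suc (n + j - Suc k) = n + j - k" using Suc.prems by simp
    then show ?case using Suc that step[of j "n + j - Suc k"] by simp
  qed
  have outer: "reaches (chain_vector ?N (n - k) (n + (n - k)))" if "k < n" for k
    using that
  proof (induction k)
    case 0 then show ?case using start by simp
  next
    case (Suc k)
    then have "reaches (chain_vector ?N (n - k) (n - k))" using inner[of "n - k" n] by simp
    \<comment> \<open>With its entry at the minimum, the vector for \<open>n - k\<close> coincides
      with the vector for the next lower index at the maximum, so the chain passes on without a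
      step.\<close>
    then show ?case by (rule cong) (use Suc.prems in \<open>auto simp: chain_vector_def\<close>)
  qed
  \<comment> \<open>This vector is the identity, the smallest bracket vector, so the chain ends at
    the top.\<close>
  have "reaches (chain_vector ?N 1 1)" using inner[of 1 n] outer[of "n - 1"] n by simp
  then obtain xs where xs: "xs \<noteq> []" "least ?L (hd xs) (TB n)" "last xs \<in> TB n"
      "\<forall>i\<in>{1..n + 1}. bracket_of n (last xs) i = chain_vector ?N 1 1 i"
      "successively (covered_by ?L) xs" "\<forall>S\<in>set xs. left_modular ?L S"
    unfolding reaches_def by blast
  have "\<And>i. i \<in> {1..n + 1} \<Longrightarrow> bracket_of n (last xs) i = i"
    using xs(4) by (auto simp: chain_vector_def)
  then have "greatest ?L (last xs) (TB n)"
    unfolding greatest_def using tamari_B_top[OF n xs(3)] xs(3) by auto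
  then show "\<exists>xs. unrefinable_left_modular_chain ?L xs"
    unfolding unrefinable_left_modular_chain_def using xs by auto
qed

end
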